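(* Let $S=\mathcal{S}[Y;A_\alpha,\phi_{\alpha,\beta}]$ be a strong semilattice of monoids. Then $S$ is of type left-$\mathrm{FP}_n$ if and only if $Y$ has a minimal element $e$, and the monoid $A_e$ is of type left-$\mathrm{FP}_n$.
   Context: For a monoid $S$, $\mathbb{Z}S$ denotes the integral monoid ring, and $\mathbb{Z}$ is regarded as the trivial left $\mathbb{Z}S$-module via the augmentation $\epsilon_S:\mathbb{Z}S\to\mathbb{Z}$, $s\mapsto 1$ ($s\in S$). For $n\geq 0$ the monoid $S$ is of type left-$\mathrm{FP}_n$ if there is an exact sequence $A_n\to A_{n-1}\to\cdots\to A_0\to\mathbb{Z}\to 0$ of left $\mathbb{Z}S$-modules with $A_0,\ldots,A_n$ finitely generated free left $\mathbb{Z}S$-modules. A semigroup $S$ without a two-sided identity is of type left-$\mathrm{FP}_n$ if the monoid $S^1=S\cup\{1\}$, obtained by adjoining an identity element, is. Strong semilattice of monoids: let $Y=(Y,\leq)$ be a semilattice (a commutative semigroup of idempotents, with $\beta\leq\alpha$ iff $\alpha\beta=\beta$, so $\alpha\beta$ is the meet), and let $A_\alpha$ ($\alpha\in Y$) be a family of disjoint monoids. Suppose that for all $\alpha,\beta\in Y$ with $\beta\leq\alpha$ there is a homomorphism $\phi_{\alpha,\beta}:A_\alpha\to A_\beta$ such that $\phi_{\alpha,\alpha}$ is the identity on $A_\alpha$ and $\phi_{\alpha,\beta}\phi_{\beta,\gamma}=\phi_{\alpha,\gamma}$ whenever $\gamma\leq\beta\leq\alpha$ (maps written on the right, composed left to right).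 Then $\mathcal{S}[Y;A_\alpha,\phi_{\alpha,\beta}]$ is the set $S=\bigcup_{\alpha\in Y}A_\alpha$ with multiplication $ab=(a\phi_{\alpha,\alpha\beta})(b\phi_{\beta,\alpha\beta})$ for $a\in A_\alpha$, $b\in A_\beta$.
   Formalization: The statement is proved for n ≥ 1 and nonempty Y; for n = 0 it is false, since every monoid is of type left-FP_0 while Y (for example an infinite descending chain of trivial monoids) may have no minimal element. *)

theory Defs
  imports "HOL-Algebra.Module" "HOL-Algebra.AbelCoset" "HOL-Library.Poly_Mapping"
begin

definition monoid_ring :: "'s monoid \<Rightarrow> ('s \<Rightarrow>\<^sub>0 int) ring" where
  "monoid_ring S =
    \<lparr>carrier = {f. Poly_Mapping.keys f \<subseteq> carrier S},
     mult = (\<lambda>f g. \<Sum>s\<in>Poly_Mapping.keys f. \<Sum>t\<in>Poly_Mapping.keys g.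
               Poly_Mapping.single (s \<otimes>\<^bsub>S\<^esub> t)
                 (Poly_Mapping.lookup f s * Poly_Mapping.lookup g t)),
     one = Poly_Mapping.single \<one>\<^bsub>S\<^esub> 1,
     zero = 0,
     add = (+)\<rparr>"

definition augmentation :: "('s \<Rightarrow>\<^sub>0 int) \<Rightarrow> int" where
  "augmentation f = (\<Sum>s\<in>Poly_Mapping.keys f. Poly_Mapping.lookup f s)"

text \<open>The library's locale \<open>module\<close> insists on a commutative ring; the axioms below are
  otherwise the same. The fields \<open>mult\<close> and \<open>one\<close> of the module record play no role.\<close>

locale left_module = R?: ring R + M?: abelian_group M
  for R (structure) and M (structure) +
  assumes smult_closed:
      "\<lbrakk>a \<in> carrier R; x \<in> carrier M\<rbrakk> \<Longrightarrow> a \<odot>\<^bsub>M\<^esub> x \<in> carrier M"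
    and smult_l_distr:
      "\<lbrakk>a \<in> carrier R; b \<in> carrier R; x \<in> carrier M\<rbrakk> \<Longrightarrow>
        (a \<oplus> b) \<odot>\<^bsub>M\<^esub> x = a \<odot>\<^bsub>M\<^esub> x \<oplus>\<^bsub>M\<^esub> b \<odot>\<^bsub>M\<^esub> x"
    and smult_r_distr:
      "\<lbrakk>a \<in> carrier R; x \<in> carrier M; y \<in> carrier M\<rbrakk> \<Longrightarrow>
        a \<odot>\<^bsub>M\<^esub> (x \<oplus>\<^bsub>M\<^esub> y) = a \<odot>\<^bsub>M\<^esub> x \<oplus>\<^bsub>M\<^esub> a \<odot>\<^bsub>M\<^esub> y"
    and smult_assoc:
      "\<lbrakk>a \<in> carrier R; b \<in> carrier R; x \<in> carrier M\<rbrakk> \<Longrightarrow>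
        (a \<otimes> b) \<odot>\<^bsub>M\<^esub> x = a \<odot>\<^bsub>M\<^esub> (b \<odot>\<^bsub>M\<^esub> x)"
    and smult_one: "x \<in> carrier M \<Longrightarrow> \<one> \<odot>\<^bsub>M\<^esub> x = x"

definition left_module_hom ::
    "'r ring \<Rightarrow> ('r, 'a) module \<Rightarrow> ('r, 'b) module \<Rightarrow> ('a \<Rightarrow> 'b) set" where
  "left_module_hom R M N =
    {h. h \<in> carrier M \<rightarrow> carrier N \<and>
        (\<forall>x\<in>carrier M. \<forall>y\<in>carrier M. h (x \<oplus>\<^bsub>M\<^esub> y) = h x \<oplus>\<^bsub>N\<^esub> h y) \<and>
        (\<forall>r\<in>carrier R. \<forall>x\<in>carrier M. h (r \<odot>\<^bsub>M\<^esub> x) = r \<odot>\<^bsub>N\<^esub> h x)}"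

definition fg_free_left_module :: "'r ring \<Rightarrow> ('r, 'a) module \<Rightarrow> bool" where
  "fg_free_left_module R M \<longleftrightarrow>
    left_module R M \<and>
    (\<exists>B. finite B \<and> B \<subseteq> carrier M \<and>
      (\<forall>x\<in>carrier M. \<exists>!c. c \<in> B \<rightarrow>\<^sub>E carrier R \<and> x = (\<Oplus>\<^bsub>M\<^esub>b\<in>B. c b \<odot>\<^bsub>M\<^esub> b)))"

definition trivial_left_module :: "(('s \<Rightarrow>\<^sub>0 int), int) module" where
  "trivial_left_module =
    \<lparr>carrier = UNIV, mult = (*), one = 1, zero = 0, add = (+),
     smult = (\<lambda>f z. augmentation f * z)\<rparr>"

text \<open>\<open>d i\<close> is the map from \<open>A (i + 1)\<close> to \<open>A i\<close>; nothing is required of the kernel of the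
  leftmost map. The quantified modules live on the type \<open>nat \<Rightarrow> 's \<Rightarrow>\<^sub>0 int\<close>, which is
  no restriction: every finitely generated free left module over the monoid ring \<open>R\<close> of
  \<open>S\<close> is isomorphic to some \<open>R\<^sup>k\<close>, and the latter is realised on this type by the
  sequences that vanish from position \<open>k\<close> on.\<close>

definition monoid_left_FP :: "nat \<Rightarrow> 's monoid \<Rightarrow> bool" where
  "monoid_left_FP n S \<longleftrightarrow>
    (\<exists>(A :: nat \<Rightarrow> ('s \<Rightarrow>\<^sub>0 int, nat \<Rightarrow> 's \<Rightarrow>\<^sub>0 int) module) d \<epsilon>.
      (\<forall>i\<le>n. fg_free_left_module (monoid_ring S) (A i)) \<and>
      (\<forall>i<n. d i \<in> left_module_hom (monoid_ring S) (A (Suc i)) (A i)) \<and>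
      \<epsilon> \<in> left_module_hom (monoid_ring S) (A 0) trivial_left_module \<and>
      \<epsilon> ` carrier (A 0) = carrier (trivial_left_module :: ('s \<Rightarrow>\<^sub>0 int, int) module) \<and>
      (0 < n \<longrightarrow> d 0 ` carrier (A 1) =
        a_kernel (A 0) (trivial_left_module :: ('s \<Rightarrow>\<^sub>0 int, int) module) \<epsilon>) \<and>
      (\<forall>i. Suc i < n \<longrightarrow>
        d (Suc i) ` carrier (A (Suc (Suc i))) = a_kernel (A (Suc i)) (A i) (d i)))"

definition identity_of :: "'s set \<Rightarrow> ('s \<Rightarrow> 's \<Rightarrow> 's) \<Rightarrow> 's \<Rightarrow> bool" where
  "identity_of S m u \<longleftrightarrow> u \<in> S \<and> (\<forall>s\<in>S. m u s = s \<and> m s u = s)"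

definition adjoin_identity :: "'s set \<Rightarrow> ('s \<Rightarrow> 's \<Rightarrow> 's) \<Rightarrow> 's option monoid" where
  "adjoin_identity S m =
    \<lparr>carrier = insert None (Some ` S),
     mult = (\<lambda>x y. case x of None \<Rightarrow> y | Some s \<Rightarrow>
              (case y of None \<Rightarrow> x | Some t \<Rightarrow> Some (m s t))),
     one = None\<rparr>"

text \<open>A semigroup is given by its carrier and its multiplication. An identity element, if there
  is one, is unique, so the description operator below picks it.\<close>

definition semigroup_left_FP :: "nat \<Rightarrow> 's set \<Rightarrow> ('s \<Rightarrow> 's \<Rightarrow> 's) \<Rightarrow> bool" where
  "semigroup_left_FP n S m \<longleftrightarrow>
    (if \<exists>u. identity_of S m u
     then monoid_left_FP n \<lparr>carrier = S, mult = m, one = (THE u. identity_of S m u)\<rparr>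
     else monoid_left_FP n (adjoin_identity S m))"

text \<open>The semilattice is a type of class \<open>semilattice_inf\<close>, with product \<open>inf\<close>. As usual
  for semigroups it is nonempty. The structure maps are homomorphisms in the sense of \<open>hom\<close>,
  that is, multiplicative maps; they are not required to preserve identity elements.\<close>

locale strong_semilattice_of_monoids =
  fixes A :: "'y::semilattice_inf \<Rightarrow> 'a monoid"
    and \<phi> :: "'y \<Rightarrow> 'y \<Rightarrow> 'a \<Rightarrow> 'a"
  assumes monoid_component: "monoid (A \<alpha>)"
    and disjoint_components: "\<alpha> \<noteq> \<beta> \<Longrightarrow> carrier (A \<alpha>) \<inter> carrier (A \<beta>) = {}"
    and structure_hom: "\<beta> \<le> \<alpha> \<Longrightarrow> \<phi> \<alpha> \<beta> \<in> hom (A \<alpha>) (A \<beta>)"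
    and structure_id: "a \<in> carrier (A \<alpha>) \<Longrightarrow> \<phi> \<alpha> \<alpha> a = a"
    and structure_comp:
      "\<lbrakk>\<gamma> \<le> \<beta>; \<beta> \<le> \<alpha>; a \<in> carrier (A \<alpha>)\<rbrakk> \<Longrightarrow> \<phi> \<beta> \<gamma> (\<phi> \<alpha> \<beta> a) = \<phi> \<alpha> \<gamma> a"

definition strong_semilattice_carrier :: "('y \<Rightarrow> 'a monoid) \<Rightarrow> 'a set" where
  "strong_semilattice_carrier A = (\<Union>\<alpha>. carrier (A \<alpha>))"

definition component_index :: "('y \<Rightarrow> 'a monoid) \<Rightarrow> 'a \<Rightarrow> 'y" where
  "component_index A a = (THE \<alpha>. a \<in> carrier (A \<alpha>))"

definition strong_semilattice_mult ::
    "('y::semilattice_inf \<Rightarrow> 'a monoid) \<Rightarrow> ('y \<Rightarrow> 'y \<Rightarrow> 'a \<Rightarrow> 'a) \<Rightarrow> 'a \<Rightarrow> 'a \<Rightarrow> 'a" where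
  "strong_semilattice_mult A \<phi> a b =
    (let \<alpha> = component_index A a; \<beta> = component_index A b; \<gamma> = inf \<alpha> \<beta>
     in \<phi> \<alpha> \<gamma> a \<otimes>\<^bsub>A \<gamma>\<^esub> \<phi> \<beta> \<gamma> b)"

end

theory Submission
  imports Defs
begin

text \<open>Let \<open>T\<close> be \<open>S\<close> if \<open>S\<close> has an identity and \<open>S\<close> with an identity adjoined otherwise. The
proof compares the rings \<open>\<int>T\<close> and \<open>\<int>A\<^sub>e\<close>, where \<open>e\<close> is the minimal, hence least, element
of \<open>Y\<close>.

If \<open>Y\<close> has a least element \<open>e\<close>, then the identity \<open>z\<close> of \<open>A\<^sub>e\<close> is a central idempotent of
\<open>T\<close>, because both \<open>s z\<close> and \<open>z s\<close> are the image of \<open>s\<close> in \<open>A\<^sub>e\<close>. So \<open>s \<mapsto> s z\<close> is a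
homomorphism of monoids from \<open>T\<close> onto \<open>A\<^sub>e\<close>; it preserves the identity even if the structure maps
do not. On the level of rings, \<open>\<int>T\<close> is the direct product of \<open>\<int>T z\<close>, a copy of \<open>\<int>A\<^sub>e\<close>, and
\<open>\<int>T (1 - z)\<close>, and the second factor annihilates the trivial module. Multiplication by \<open>z\<close> is
exact, so it turns a resolution over \<open>\<int>T\<close> into one over \<open>\<int>A\<^sub>e\<close>
(\<open>partial_resolution_descend\<close>).

Conversely, a free resolution \<open>F\<close> over \<open>\<int>A\<^sub>e\<close> is only a projective one over \<open>\<int>T\<close>. To make it
free, one adds contractible complexes, over the first factor and over the second, until the two
factors occur with equal ranks in each degree. If \<open>F\<^sub>i\<close> has rank \<open>k\<^sub>i\<close>, then
\<open>k\<^sub>0 + \<dots> + k\<^sub>i\<close> copies of \<open>\<int>T\<close> in degree \<open>i\<close> suffice, with the explicit differential \<open>pad_map\<close>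
(\<open>partial_resolution_ascend\<close>). Together this gives \<open>monoid_left_FP_retract\<close>.

That \<open>Y\<close> has a least element follows from type \<open>FP\<^sub>1\<close> alone, by a general principle
(\<open>global_fixed_point\<close>): if a monoid of type left-\<open>FP\<^sub>1\<close> acts on a set so that each finite subset
of the monoid has a common fixed point, then the whole monoid has one. The monoid \<open>T\<close> acts on \<open>Y\<close>
by taking meets with the index of an element of \<open>S\<close>. An element of \<open>Y\<close> is fixed by \<open>s\<close> iff it lies
below the index of \<open>s\<close>; so each finite subset has a common fixed point, and a fixed point of all of
\<open>T\<close> is a least element of \<open>Y\<close>.\<close>

section \<open>Monoid rings\<close>

text \<open>The extension by biadditivity of a map \<open>q\<close>. For an action of a monoid on a set it is
the scalar multiplication of the permutation module, and for the multiplication of a monoid it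
is the product of the monoid ring, so that both obey the same laws.\<close>

definition frag_action :: "('s \<Rightarrow> 'x \<Rightarrow> 'x) \<Rightarrow> ('s \<Rightarrow>\<^sub>0 int) \<Rightarrow> ('x \<Rightarrow>\<^sub>0 int) \<Rightarrow> 'x \<Rightarrow>\<^sub>0 int" where
  "frag_action q f m = frag_extend (\<lambda>s. frag_extend (\<lambda>x. frag_of (q s x)) m) f"

lemma frag_extend_diff_fun:
  "frag_extend (\<lambda>s. g s - h s) f = frag_extend g f - frag_extend h f"
  by (induction f rule: frag_induction[OF subset_UNIV]) (auto simp: frag_extend_diff)

lemma frag_action_0 [simp]: "frag_action q 0 m = 0" "frag_action q f 0 = 0"
  by (auto simp: frag_action_def frag_extend_eq_0)

lemma frag_action_of [simp]: "frag_action q (frag_of s) (frag_of x) = frag_of (q s x)"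
  by (simp add: frag_action_def)

lemma frag_action_diff_left: "frag_action q (f - g) m = frag_action q f m - frag_action q g m"
  by (simp add: frag_action_def frag_extend_diff)

lemma frag_action_diff_right: "frag_action q f (m - k) = frag_action q f m - frag_action q f k"
  by (simp add: frag_action_def frag_extend_diff frag_extend_diff_fun)

lemma frag_action_add_left: "frag_action q (f + g) m = frag_action q f m + frag_action q g m"
  by (simp add: frag_action_def frag_extend_add)

lemma frag_action_add_right: "frag_action q f (m + k) = frag_action q f m + frag_action q f k"
  using frag_action_diff_right[of q f "m + k" k] by (simp add: algebra_simps)

lemma frag_extend_cmul_fun:
  "frag_extend (\<lambda>s. frag_cmul c (g s)) f = frag_cmul c (frag_extend g f)"
  by (simp add: frag_extend_def frag_cmul_sum mult.commute)

lemma frag_action_cmul_right: "frag_action q f (frag_cmul c m) = frag_cmul c (frag_action q f m)"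
  by (simp add: frag_action_def frag_extend_cmul frag_extend_cmul_fun)

lemma keys_frag_action:
  assumes "Poly_Mapping.keys f \<subseteq> U" "Poly_Mapping.keys m \<subseteq> V" "\<And>s x. s \<in> U \<Longrightarrow> x \<in> V \<Longrightarrow> q s x \<in> W"
  shows "Poly_Mapping.keys (frag_action q f m) \<subseteq> W"
proof -
  have "Poly_Mapping.keys (frag_extend (\<lambda>x. frag_of (q s x)) m) \<subseteq> W" if "s \<in> U" for s
    by (rule order_trans[OF keys_frag_extend]) (use assms that in auto)
  then show ?thesis
    unfolding frag_action_def by (intro order_trans[OF keys_frag_extend]) (use assms(1) in blast)
qed

lemma frag_action_assoc:
  assumes "Poly_Mapping.keys f \<subseteq> U" "Poly_Mapping.keys g \<subseteq> U" "Poly_Mapping.keys m \<subseteq> V"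
    and "\<And>s t x. s \<in> U \<Longrightarrow> t \<in> U \<Longrightarrow> x \<in> V \<Longrightarrow> q (r s t) x = q s (q t x)"
  shows "frag_action q (frag_action r f g) m = frag_action q f (frag_action q g m)"
  using assms(1)
proof (induction f rule: frag_induction)
  case (one s)
  show ?case using assms(2)
  proof (induction g rule: frag_induction)
    case (one t)
    show ?case using assms(3)
      by (induction m rule: frag_induction)
        (use assms(4) \<open>s \<in> U\<close> one in \<open>auto simp: frag_action_diff_right\<close>)
  qed (auto simp: frag_action_diff_left frag_action_diff_right)
qed (auto simp: frag_action_diff_left)

lemma monoid_ring_simps [simp]:
  "carrier (monoid_ring S) = {f. Poly_Mapping.keys f \<subseteq> carrier S}"
  "f \<otimes>\<^bsub>monoid_ring S\<^esub> g = frag_action (mult S) f g"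
  "\<one>\<^bsub>monoid_ring S\<^esub> = frag_of \<one>\<^bsub>S\<^esub>"
  "\<zero>\<^bsub>monoid_ring S\<^esub> = 0"
  "f \<oplus>\<^bsub>monoid_ring S\<^esub> g = f + g"
proof -
  have "frag_cmul a (frag_cmul b (frag_of x)) = Poly_Mapping.single x (a * b)" for a b and x :: 'a
    by (rule poly_mapping_eqI) (simp add: lookup_single when_def)
  then show "f \<otimes>\<^bsub>monoid_ring S\<^esub> g = frag_action (mult S) f g"
    by (simp add: monoid_ring_def frag_action_def frag_extend_def frag_cmul_sum del: frag_cmul_cmul)
qed (simp_all add: monoid_ring_def)

lemma frag_action_one:
  assumes "Poly_Mapping.keys m \<subseteq> V" "\<And>x. x \<in> V \<Longrightarrow> q e x = x"
  shows "frag_action q (frag_of e) m = m"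
  using assms(1) by (induction m rule: frag_induction) (auto simp: assms(2) frag_action_diff_right)

lemma ring_monoid_ring:
  assumes "monoid S" shows "ring (monoid_ring S)"
proof -
  interpret monoid S by fact
  have one_right: "frag_action (mult S) f (frag_of \<one>\<^bsub>S\<^esub>) = f" if "Poly_Mapping.keys f \<subseteq> carrier S" for f
    using that by (induction f rule: frag_induction) (auto simp: frag_action_diff_left)
  show ?thesis
  proof (rule ringI)
    show "abelian_group (monoid_ring S)"
    proof (rule abelian_groupI)
      fix f assume "f \<in> carrier (monoid_ring S)"
      then show "\<exists>g\<in>carrier (monoid_ring S). g \<oplus>\<^bsub>monoid_ring S\<^esub> f = \<zero>\<^bsub>monoid_ring S\<^esub>"
        by (intro bexI[of _ "- f"]) auto
    qed (use keys_add in \<open>auto simp: algebra_simps, fastforce\<close>)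
    show "monoid (monoid_ring S)"
      by (rule monoidI)
        (auto simp: one_right frag_action_one[of _ "carrier S"]
          intro!: frag_action_assoc[of _ "carrier S" _ _ "carrier S"]
          dest!: keys_frag_action[of _ "carrier S" _ "carrier S" "mult S" "carrier S", THEN subsetD, rotated -1]
          simp: m_assoc)
  qed (simp_all add: frag_action_add_left frag_action_add_right)
qed

text \<open>This makes the augmentation a value of \<open>frag_extend\<close>, from which it inherits additivity.\<close>

lemma augmentation_altdef: "augmentation f = Poly_Mapping.lookup (frag_extend (\<lambda>_. frag_of ()) f) ()"
  by (simp add: augmentation_def frag_extend_def Poly_Mapping.lookup_sum)

lemma augmentation_simps [simp]: "augmentation 0 = 0" "augmentation (frag_of s) = 1"
  by (simp_all add: augmentation_altdef)

lemma augmentation_add: "augmentation (f + g) = augmentation f + augmentation g"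
  by (simp add: augmentation_altdef frag_extend_add lookup_add)

lemma augmentation_diff: "augmentation (f - g) = augmentation f - augmentation g"
  by (simp add: augmentation_altdef frag_extend_diff lookup_minus)

lemma augmentation_frag_action: "augmentation (frag_action q f m) = augmentation f * augmentation m"
proof (induction f rule: frag_induction[OF subset_UNIV])
  case (2 s)
  show ?case
    by (induction m rule: frag_induction[OF subset_UNIV])
      (simp_all add: augmentation_diff frag_action_diff_right)
qed (simp_all add: augmentation_diff frag_action_diff_left algebra_simps)

lemma trivial_left_module_simps [simp]:
  "carrier trivial_left_module = UNIV"
  "\<zero>\<^bsub>trivial_left_module\<^esub> = 0"
  "x \<oplus>\<^bsub>trivial_left_module\<^esub> y = x + y"
  "f \<odot>\<^bsub>trivial_left_module\<^esub> x = augmentation f * x"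
  by (simp_all add: trivial_left_module_def)

lemma left_module_trivial:
  assumes "monoid S" shows "left_module (monoid_ring S) trivial_left_module"
proof -
  interpret ring "monoid_ring S" by (rule ring_monoid_ring[OF assms])
  have "abelian_group trivial_left_module"
    by (rule abelian_groupI) (auto intro: exI[of _ "- _"])
  then show ?thesis
    by (intro left_module.intro left_module_axioms.intro ring_axioms)
      (auto simp: augmentation_add augmentation_frag_action algebra_simps)
qed

section \<open>Finitely generated free modules\<close>

context left_module
begin

lemma smult_r_null:
  assumes "r \<in> carrier R" shows "r \<odot>\<^bsub>M\<^esub> \<zero>\<^bsub>M\<^esub> = \<zero>\<^bsub>M\<^esub>"
proof -
  have "r \<odot>\<^bsub>M\<^esub> \<zero>\<^bsub>M\<^esub> \<oplus>\<^bsub>M\<^esub> r \<odot>\<^bsub>M\<^esub> \<zero>\<^bsub>M\<^esub> = r \<odot>\<^bsub>M\<^esub> \<zero>\<^bsub>M\<^esub>"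
    using smult_r_distr[OF assms, of "\<zero>\<^bsub>M\<^esub>" "\<zero>\<^bsub>M\<^esub>"] by simp
  then show ?thesis
    using assms by (simp add: M.add.r_cancel_one smult_closed)
qed

lemma finsum_smult_ldistr:
  assumes "finite I" "r \<in> carrier R" "f \<in> I \<rightarrow> carrier M"
  shows "r \<odot>\<^bsub>M\<^esub> (\<Oplus>\<^bsub>M\<^esub>i\<in>I. f i) = (\<Oplus>\<^bsub>M\<^esub>i\<in>I. r \<odot>\<^bsub>M\<^esub> f i)"
  using assms
proof (induction I rule: finite_induct)
  case (insert i I)
  then have "f i \<in> carrier M" "f \<in> I \<rightarrow> carrier M" "(\<lambda>i. r \<odot>\<^bsub>M\<^esub> f i) \<in> I \<rightarrow> carrier M"
    by (auto simp: smult_closed Pi_iff)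
  with insert show ?case
    by (simp add: smult_r_distr smult_closed)
qed (simp add: smult_r_null)

end

lemma left_module_hom_zero:
  assumes "left_module R M" "left_module R N" "h \<in> left_module_hom R M N"
  shows "h \<zero>\<^bsub>M\<^esub> = \<zero>\<^bsub>N\<^esub>"
proof -
  interpret M: left_module R M by fact
  interpret N: left_module R N by fact
  have "h \<zero>\<^bsub>M\<^esub> \<in> carrier N" "h (\<zero>\<^bsub>M\<^esub> \<oplus>\<^bsub>M\<^esub> \<zero>\<^bsub>M\<^esub>) = h \<zero>\<^bsub>M\<^esub> \<oplus>\<^bsub>N\<^esub> h \<zero>\<^bsub>M\<^esub>"
    using assms(3) M.M.zero_closed by (auto simp: left_module_hom_def simp del: M.M.l_zero M.M.r_zero)
  then show ?thesis by (simp add: N.M.add.r_cancel_one)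
qed

lemma left_module_hom_compose:
  assumes "g \<in> left_module_hom R L M" "h \<in> left_module_hom R M N"
  shows "h \<circ> g \<in> left_module_hom R L N"
  using assms by (auto simp: left_module_hom_def Pi_iff)

lemma left_module_hom_inv_into:
  assumes "left_module R M" "h \<in> left_module_hom R M N" "bij_betw h (carrier M) (carrier N)"
  shows "inv_into (carrier M) h \<in> left_module_hom R N M"
proof -
  interpret M: left_module R M by fact
  let ?g = "inv_into (carrier M) h"
  have inj: "inj_on h (carrier M)" and im: "h ` carrier M = carrier N"
    using assms(3) by (auto simp: bij_betw_def)
  have closed: "?g x \<in> carrier M" and right_inv: "h (?g x) = x" if "x \<in> carrier N" for x
    using that im by (auto simp: inv_into_into f_inv_into_f)
  have eqI: "?g x = y" if "y \<in> carrier M" "h y = x" for x y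
    using that inj by auto
  show ?thesis
    using assms(2) closed right_inv
    by (auto simp: left_module_hom_def M.smult_closed intro!: eqI)
qed

text \<open>The free module \<open>R\<^sup>I\<close>. Its elements vanish off \<open>I\<close>, so that they are determined by their
coordinates in \<open>I\<close> while all operations remain pointwise.\<close>

definition free_left_module :: "('r, 'm) ring_scheme \<Rightarrow> 'i set \<Rightarrow> ('r, 'i \<Rightarrow> 'r) module" where
  "free_left_module R I =
    \<lparr>carrier = {x. (\<forall>i\<in>I. x i \<in> carrier R) \<and> (\<forall>i. i \<notin> I \<longrightarrow> x i = \<zero>\<^bsub>R\<^esub>)},
     mult = undefined, one = undefined,
     zero = (\<lambda>_. \<zero>\<^bsub>R\<^esub>), add = (\<lambda>x y i. x i \<oplus>\<^bsub>R\<^esub> y i),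
     smult = (\<lambda>r x i. r \<otimes>\<^bsub>R\<^esub> x i)\<rparr>"

definition unit_vector :: "('r, 'm) ring_scheme \<Rightarrow> 'i \<Rightarrow> 'i \<Rightarrow> 'r" where
  "unit_vector R i = (\<lambda>k. if k = i then \<one>\<^bsub>R\<^esub> else \<zero>\<^bsub>R\<^esub>)"

lemma free_left_module_simps [simp]:
  "\<zero>\<^bsub>free_left_module R I\<^esub> = (\<lambda>_. \<zero>\<^bsub>R\<^esub>)"
  "x \<oplus>\<^bsub>free_left_module R I\<^esub> y = (\<lambda>i. x i \<oplus>\<^bsub>R\<^esub> y i)"
  "r \<odot>\<^bsub>free_left_module R I\<^esub> x = (\<lambda>i. r \<otimes>\<^bsub>R\<^esub> x i)"
  by (simp_all add: free_left_module_def)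

lemma carrier_free_left_module:
  "x \<in> carrier (free_left_module R I) \<longleftrightarrow>
    (\<forall>i\<in>I. x i \<in> carrier R) \<and> (\<forall>i. i \<notin> I \<longrightarrow> x i = \<zero>\<^bsub>R\<^esub>)"
  by (simp add: free_left_module_def)

context ring
begin

lemma free_left_module_coord_closed [simp, intro]:
  "x \<in> carrier (free_left_module R I) \<Longrightarrow> x i \<in> carrier R"
  by (cases "i \<in> I") (auto simp: carrier_free_left_module)

lemma left_module_free: "left_module R (free_left_module R I)"
proof (intro left_module.intro left_module_axioms.intro ring_axioms)
  show "abelian_group (free_left_module R I)"
  proof (rule abelian_groupI)
    fix x assume x: "x \<in> carrier (free_left_module R I)"
    show "\<exists>y\<in>carrier (free_left_module R I).
        y \<oplus>\<^bsub>free_left_module R I\<^esub> x = \<zero>\<^bsub>free_left_module R I\<^esub>"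
      using free_left_module_coord_closed[OF x] x
      by (intro bexI[of _ "\<lambda>i. \<ominus> x i"]) (auto simp: carrier_free_left_module l_neg)
  next
    fix x assume x: "x \<in> carrier (free_left_module R I)"
    show "\<zero>\<^bsub>free_left_module R I\<^esub> \<oplus>\<^bsub>free_left_module R I\<^esub> x = x"
      using free_left_module_coord_closed[OF x] by simp
  next
    fix x y z assume "x \<in> carrier (free_left_module R I)" "y \<in> carrier (free_left_module R I)"
      "z \<in> carrier (free_left_module R I)"
    note this[THEN free_left_module_coord_closed]
    then show "x \<oplus>\<^bsub>free_left_module R I\<^esub> y \<oplus>\<^bsub>free_left_module R I\<^esub> z =
        x \<oplus>\<^bsub>free_left_module R I\<^esub> (y \<oplus>\<^bsub>free_left_module R I\<^esub> z)"
      by (simp add: a_assoc)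
  next
    fix x y assume "x \<in> carrier (free_left_module R I)" "y \<in> carrier (free_left_module R I)"
    note this[THEN free_left_module_coord_closed]
    then show "x \<oplus>\<^bsub>free_left_module R I\<^esub> y = y \<oplus>\<^bsub>free_left_module R I\<^esub> x"
      by (simp add: a_comm)
  qed (auto simp: carrier_free_left_module)
next
  fix a b x assume *: "a \<in> carrier R" "b \<in> carrier R" "x \<in> carrier (free_left_module R I)"
  note c = free_left_module_coord_closed[OF *(3)]
  show "(a \<oplus> b) \<odot>\<^bsub>free_left_module R I\<^esub> x =
      a \<odot>\<^bsub>free_left_module R I\<^esub> x \<oplus>\<^bsub>free_left_module R I\<^esub> b \<odot>\<^bsub>free_left_module R I\<^esub> x"
    "(a \<otimes> b) \<odot>\<^bsub>free_left_module R I\<^esub> x = a \<odot>\<^bsub>free_left_module R I\<^esub> (b \<odot>\<^bsub>free_left_module R I\<^esub> x)"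
    using * c by (simp_all add: l_distr m_assoc)
next
  fix a x y assume *: "a \<in> carrier R"
    "x \<in> carrier (free_left_module R I)" "y \<in> carrier (free_left_module R I)"
  then show "a \<odot>\<^bsub>free_left_module R I\<^esub> (x \<oplus>\<^bsub>free_left_module R I\<^esub> y) =
      a \<odot>\<^bsub>free_left_module R I\<^esub> x \<oplus>\<^bsub>free_left_module R I\<^esub> a \<odot>\<^bsub>free_left_module R I\<^esub> y"
    using *(2,3)[THEN free_left_module_coord_closed] by (simp add: r_distr)
next
  fix x assume "x \<in> carrier (free_left_module R I)"
  then show "\<one> \<odot>\<^bsub>free_left_module R I\<^esub> x = x"
    using free_left_module_coord_closed[of x] by simp
qed (auto simp: carrier_free_left_module)

lemma unit_vector_closed: "i \<in> I \<Longrightarrow> unit_vector R i \<in> carrier (free_left_module R I)"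
  by (auto simp: carrier_free_left_module unit_vector_def)

lemma finsum_free_left_module:
  assumes "finite J" "f \<in> J \<rightarrow> carrier (free_left_module R I)"
  shows "(\<Oplus>\<^bsub>free_left_module R I\<^esub>j\<in>J. f j) i = (\<Oplus>j\<in>J. f j i)"
proof -
  interpret F: left_module R "free_left_module R I" by (rule left_module_free)
  show ?thesis
    using assms
  proof (induction J rule: finite_induct)
    case (insert j J)
    then have "f \<in> J \<rightarrow> carrier (free_left_module R I)" "f j \<in> carrier (free_left_module R I)"
      "f j i \<in> carrier R" "(\<lambda>j. f j i) \<in> J \<rightarrow> carrier R"
      using free_left_module_coord_closed[of _ I i] by (auto simp: Pi_iff)
    with insert show ?case by simp
  qed simp
qed

lemma linear_combination_unit_vectors:
  assumes "finite I" and c: "\<And>i. i \<in> I \<Longrightarrow> c i \<in> carrier R"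
  shows "(\<Oplus>\<^bsub>free_left_module R I\<^esub>i\<in>I. c i \<odot>\<^bsub>free_left_module R I\<^esub> unit_vector R i) k =
    (if k \<in> I then c k else \<zero>)" (is "?s k = _")
proof -
  interpret F: left_module R "free_left_module R I" by (rule left_module_free)
  have "?s k = (\<Oplus>i\<in>I. (c i \<odot>\<^bsub>free_left_module R I\<^esub> unit_vector R i) k)"
    by (rule finsum_free_left_module[OF assms(1)])
      (use c F.smult_closed[OF _ unit_vector_closed] in blast)
  also have "\<dots> = (\<Oplus>i\<in>I. if k = i then c i else \<zero>)"
    using c by (intro finsum_cong') (auto simp: unit_vector_def)
  also have "\<dots> = (if k \<in> I then c k else \<zero>)"
    using add.finprod_singleton[of k I c] c assms(1)
    by (cases "k \<in> I") (auto intro!: add.finprod_one_eqI)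
  finally show ?thesis .
qed

lemma free_left_module_expansion:
  assumes "finite I" "x \<in> carrier (free_left_module R I)"
  shows "x = (\<Oplus>\<^bsub>free_left_module R I\<^esub>i\<in>I. x i \<odot>\<^bsub>free_left_module R I\<^esub> unit_vector R i)"
  using assms linear_combination_unit_vectors[OF assms(1), of x]
  by (intro ext) (simp add: carrier_free_left_module)

text \<open>The elements with property \<open>P\<close> form a submodule that contains a basis. For \<open>P\<close> an equation between
linear maps this is the principle that such maps are determined by their values on unit vectors.\<close>

lemma free_left_module_induct [consumes 2, case_names unit add smult zero]:
  assumes "finite I" "x \<in> carrier (free_left_module R I)"
    and unit: "\<And>i. i \<in> I \<Longrightarrow> P (unit_vector R i)"
    and add: "\<And>x y. \<lbrakk>x \<in> carrier (free_left_module R I); y \<in> carrier (free_left_module R I); P x; P y\<rbrakk>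
        \<Longrightarrow> P (x \<oplus>\<^bsub>free_left_module R I\<^esub> y)"
    and smult: "\<And>r x. \<lbrakk>r \<in> carrier R; x \<in> carrier (free_left_module R I); P x\<rbrakk>
        \<Longrightarrow> P (r \<odot>\<^bsub>free_left_module R I\<^esub> x)"
    and zero: "P \<zero>\<^bsub>free_left_module R I\<^esub>"
  shows "P x"
proof -
  interpret F: left_module R "free_left_module R I" by (rule left_module_free)
  let ?f = "\<lambda>i. x i \<odot>\<^bsub>free_left_module R I\<^esub> unit_vector R i"
  have f: "?f i \<in> carrier (free_left_module R I)" "P (?f i)" if "i \<in> I" for i
    using F.smult_closed[OF _ unit_vector_closed[OF that]] smult[OF _ unit_vector_closed unit, OF _ that that]
      free_left_module_coord_closed[OF assms(2)] by blast+
  have "P (\<Oplus>\<^bsub>free_left_module R I\<^esub>i\<in>J. ?f i)" if "J \<subseteq> I" for J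
    using finite_subset[OF that assms(1)] that
  proof (induction J rule: finite_induct)
    case (insert j J)
    then have "?f \<in> J \<rightarrow> carrier (free_left_module R I)" using f(1) by blast
    with insert f[of j] show ?case
      by (auto simp: F.M.finsum_insert simp del: free_left_module_simps intro!: add)
  next
    case empty
    then show ?case using zero by (simp del: free_left_module_simps)
  qed
  then show ?thesis
    using free_left_module_expansion[OF assms(1,2)] by (metis order_refl)
qed

end

lemma fg_free_free_left_module:
  assumes "ring R" and fin: "finite I" and nontrivial: "\<one>\<^bsub>R\<^esub> \<noteq> \<zero>\<^bsub>R\<^esub>"
  shows "fg_free_left_module R (free_left_module R I)"
proof -
  interpret ring R by fact
  interpret F: left_module R "free_left_module R I" by (rule left_module_free)
  let ?F = "free_left_module R I" and ?e = "unit_vector R"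
  have inj: "inj_on ?e I"
  proof (rule inj_onI)
    fix i j assume "?e i = ?e j"
    then have "?e i i = ?e j i" by simp
    with nontrivial show "i = j" by (auto simp: unit_vector_def split: if_splits)
  qed
  have sum_e: "(\<Oplus>\<^bsub>?F\<^esub>b\<in>?e ` I. c b \<odot>\<^bsub>?F\<^esub> b) k = (if k \<in> I then c (?e k) else \<zero>\<^bsub>R\<^esub>)"
    if c: "c \<in> ?e ` I \<rightarrow> carrier R" for c k
  proof -
    have "(\<Oplus>\<^bsub>?F\<^esub>b\<in>?e ` I. c b \<odot>\<^bsub>?F\<^esub> b) = (\<Oplus>\<^bsub>?F\<^esub>i\<in>I. c (?e i) \<odot>\<^bsub>?F\<^esub> ?e i)"
      using c by (intro F.M.add.finprod_reindex inj)
        (auto simp del: free_left_module_simps intro!: F.smult_closed unit_vector_closed)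
    then show ?thesis
      using linear_combination_unit_vectors[OF fin, of "\<lambda>i. c (?e i)" k] c
      by (simp add: Pi_iff del: free_left_module_simps)
  qed
  show ?thesis
    unfolding fg_free_left_module_def
  proof (intro conjI exI ballI left_module_free)
    fix x assume x: "x \<in> carrier ?F"
    define c where "c = restrict (\<lambda>b. x (inv_into I ?e b)) (?e ` I)"
    show "\<exists>!c. c \<in> ?e ` I \<rightarrow>\<^sub>E carrier R \<and> x = (\<Oplus>\<^bsub>?F\<^esub>b\<in>?e ` I. c b \<odot>\<^bsub>?F\<^esub> b)"
    proof (rule ex1I[of _ c])
      have c: "c \<in> ?e ` I \<rightarrow>\<^sub>E carrier R"
        using free_left_module_coord_closed[OF x] by (auto simp: c_def)
      then have "x k = (\<Oplus>\<^bsub>?F\<^esub>b\<in>?e ` I. c b \<odot>\<^bsub>?F\<^esub> b) k" for k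
        using x sum_e[of c k] inj by (auto simp: c_def carrier_free_left_module)
      with c show "c \<in> ?e ` I \<rightarrow>\<^sub>E carrier R \<and> x = (\<Oplus>\<^bsub>?F\<^esub>b\<in>?e ` I. c b \<odot>\<^bsub>?F\<^esub> b)"
        by blast
    next
      fix c' assume c': "c' \<in> ?e ` I \<rightarrow>\<^sub>E carrier R \<and> x = (\<Oplus>\<^bsub>?F\<^esub>b\<in>?e ` I. c' b \<odot>\<^bsub>?F\<^esub> b)"
      then have "c' \<in> ?e ` I \<rightarrow> carrier R" by (auto simp: PiE_iff)
      then have c'_e: "c' (?e i) = x i" if "i \<in> I" for i
        using sum_e[of c' i] that conjunct2[OF c'] by (simp del: free_left_module_simps)
      show "c' = c"
      proof
        fix b
        show "c' b = c b"
        proof (cases "b \<in> ?e ` I")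
          case True
          then obtain i where "i \<in> I" "b = ?e i" by blast
          then show ?thesis using c'_e inj by (simp add: c_def)
        next
          case False
          then show ?thesis using PiE_arb[OF conjunct1[OF c'] False] by (simp add: c_def)
        qed
      qed
    qed
  qed (use fin unit_vector_closed in auto)
qed

text \<open>A basis indexed by numbers identifies the module with some \<open>R\<^sup>k\<close>; uniqueness of the
coefficients is injectivity.\<close>

lemma fg_free_left_module_coordinates:
  assumes "fg_free_left_module R M"
  shows "\<exists>(k::nat) \<psi>. \<psi> \<in> left_module_hom R (free_left_module R {..<k}) M \<and>
    bij_betw \<psi> (carrier (free_left_module R {..<k})) (carrier M)"
proof -
  from assms obtain B where "left_module R M" and B: "finite B" "B \<subseteq> carrier M"
    and uniq: "\<And>x. x \<in> carrier M \<Longrightarrow>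
      \<exists>!c. c \<in> B \<rightarrow>\<^sub>E carrier R \<and> x = (\<Oplus>\<^bsub>M\<^esub>b\<in>B. c b \<odot>\<^bsub>M\<^esub> b)"
    by (auto simp: fg_free_left_module_def)
  interpret left_module R M by fact
  obtain b where b: "bij_betw b {..<card B} B"
    using ex_bij_betw_nat_finite[OF B(1)] by (auto simp: atLeast0LessThan)
  let ?F = "free_left_module R {..<card B}"
  have b_in: "b i \<in> carrier M" if "i < card B" for i
    using that b B(2) by (auto dest: bij_betwE)
  define \<psi> where "\<psi> x = (\<Oplus>\<^bsub>M\<^esub>i\<in>{..<card B}. x i \<odot>\<^bsub>M\<^esub> b i)" for x
  have summand: "x i \<odot>\<^bsub>M\<^esub> b i \<in> carrier M" if "x \<in> carrier ?F" "i < card B" for x i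
    using that b_in by (auto intro: smult_closed)
  have "\<psi> \<in> left_module_hom R ?F M"
    unfolding left_module_hom_def
  proof (intro CollectI conjI ballI Pi_I)
    fix x assume "x \<in> carrier ?F" then show "\<psi> x \<in> carrier M"
      unfolding \<psi>_def by (intro M.finsum_closed) (auto intro: summand)
  next
    fix x y assume xy: "x \<in> carrier ?F" "y \<in> carrier ?F"
    then have "\<psi> (x \<oplus>\<^bsub>?F\<^esub> y) = (\<Oplus>\<^bsub>M\<^esub>i\<in>{..<card B}. x i \<odot>\<^bsub>M\<^esub> b i \<oplus>\<^bsub>M\<^esub> y i \<odot>\<^bsub>M\<^esub> b i)"
      unfolding \<psi>_def using b_in
      by (intro M.finsum_cong') (auto intro!: summand smult_l_distr)
    also have "\<dots> = \<psi> x \<oplus>\<^bsub>M\<^esub> \<psi> y"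
      unfolding \<psi>_def using xy by (intro M.finsum_addf) (auto intro: summand)
    finally show "\<psi> (x \<oplus>\<^bsub>?F\<^esub> y) = \<psi> x \<oplus>\<^bsub>M\<^esub> \<psi> y" .
  next
    fix r x assume rx: "r \<in> carrier R" "x \<in> carrier ?F"
    then have "r \<odot>\<^bsub>M\<^esub> \<psi> x = (\<Oplus>\<^bsub>M\<^esub>i\<in>{..<card B}. r \<odot>\<^bsub>M\<^esub> (x i \<odot>\<^bsub>M\<^esub> b i))"
      unfolding \<psi>_def by (intro finsum_smult_ldistr) (auto intro: summand)
    also have "\<dots> = \<psi> (r \<odot>\<^bsub>?F\<^esub> x)"
      unfolding \<psi>_def using rx b_in
      by (intro M.finsum_cong') (auto simp: smult_assoc intro!: smult_closed)
    finally show "\<psi> (r \<odot>\<^bsub>?F\<^esub> x) = r \<odot>\<^bsub>M\<^esub> \<psi> x" by simp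
  qed
  moreover have "bij_betw \<psi> (carrier ?F) (carrier M)"
  proof -
    define g where "g x = restrict (\<lambda>v. x (inv_into {..<card B} b v)) B" for x :: "nat \<Rightarrow> 'a"
    have inj: "inj_on b {..<card B}" and im: "b ` {..<card B} = B"
      using b by (auto simp: bij_betw_def)
    have g_b: "g x (b i) = x i" if "i < card B" for x i
      using that inj im by (auto simp: g_def)
    have g_in: "g x \<in> B \<rightarrow>\<^sub>E carrier R" if "x \<in> carrier ?F" for x
      using that by (auto simp: g_def)
    have \<psi>_g: "\<psi> x = (\<Oplus>\<^bsub>M\<^esub>v\<in>B. g x v \<odot>\<^bsub>M\<^esub> v)" if "x \<in> carrier ?F" for x
    proof -
      have "(\<Oplus>\<^bsub>M\<^esub>v\<in>b ` {..<card B}. g x v \<odot>\<^bsub>M\<^esub> v) = (\<Oplus>\<^bsub>M\<^esub>i\<in>{..<card B}. g x (b i) \<odot>\<^bsub>M\<^esub> b i)"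
        using that B(2) g_in[OF that] im by (intro M.add.finprod_reindex inj) (auto intro!: smult_closed)
      also have "\<dots> = \<psi> x"
        unfolding \<psi>_def using that by (intro M.finsum_cong') (auto simp: g_b intro: summand)
      finally show ?thesis using im by simp
    qed
    have \<psi>_closed: "\<psi> x \<in> carrier M" if "x \<in> carrier ?F" for x
      using \<open>\<psi> \<in> left_module_hom R ?F M\<close> that by (auto simp: left_module_hom_def)
    show ?thesis
    proof (rule bij_betwI')
      fix x y assume xy: "x \<in> carrier ?F" "y \<in> carrier ?F"
      have "x = y" if "\<psi> x = \<psi> y"
      proof -
        have "g x = g y"
          using uniq[OF \<psi>_closed[OF xy(1)]] \<psi>_g[OF xy(1)] \<psi>_g[OF xy(2)] that g_in xy by metis
        then have "x i = y i" if "i < card B" for i using g_b[OF that] by metis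
        with xy show "x = y" unfolding carrier_free_left_module by (metis ext lessThan_iff)
      qed
      then show "(\<psi> x = \<psi> y) = (x = y)" by auto
    next
      fix m assume "m \<in> carrier M"
      then obtain c where c: "c \<in> B \<rightarrow>\<^sub>E carrier R" "m = (\<Oplus>\<^bsub>M\<^esub>v\<in>B. c v \<odot>\<^bsub>M\<^esub> v)"
        using uniq by blast
      define x where "x i = (if i < card B then c (b i) else \<zero>\<^bsub>R\<^esub>)" for i
      have x: "x \<in> carrier ?F"
        using c(1) im by (auto simp: carrier_free_left_module x_def)
      moreover have "g x = c"
      proof
        fix v
        show "g x v = c v"
        proof (cases "v \<in> B")
          case True
          then obtain i where "i < card B" "v = b i" using im by blast
          then show ?thesis using g_b[of i x] by (simp add: x_def)
        next
          case False
          then show ?thesis using PiE_arb[OF c(1) False] by (simp add: g_def)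
        qed
      qed
      ultimately show "\<exists>x\<in>carrier ?F. m = \<psi> x"
        using \<psi>_g[OF x] c(2) by metis
    qed (rule \<psi>_closed)
  qed
  ultimately show ?thesis by blast
qed

section \<open>Partial resolutions\<close>

lemma left_module_hom_closed: "h \<in> left_module_hom R M N \<Longrightarrow> x \<in> carrier M \<Longrightarrow> h x \<in> carrier N"
  and left_module_hom_add: "h \<in> left_module_hom R M N \<Longrightarrow> x \<in> carrier M \<Longrightarrow> y \<in> carrier M
    \<Longrightarrow> h (x \<oplus>\<^bsub>M\<^esub> y) = h x \<oplus>\<^bsub>N\<^esub> h y"
  and left_module_hom_smult: "h \<in> left_module_hom R M N \<Longrightarrow> r \<in> carrier R \<Longrightarrow> x \<in> carrier M
    \<Longrightarrow> h (r \<odot>\<^bsub>M\<^esub> x) = r \<odot>\<^bsub>N\<^esub> h x"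
  by (auto simp: left_module_hom_def)

lemma left_module_homI:
  assumes "\<And>x. x \<in> carrier M \<Longrightarrow> h x \<in> carrier N"
    and "\<And>x y. x \<in> carrier M \<Longrightarrow> y \<in> carrier M \<Longrightarrow> h (x \<oplus>\<^bsub>M\<^esub> y) = h x \<oplus>\<^bsub>N\<^esub> h y"
    and "\<And>r x. r \<in> carrier R \<Longrightarrow> x \<in> carrier M \<Longrightarrow> h (r \<odot>\<^bsub>M\<^esub> x) = r \<odot>\<^bsub>N\<^esub> h x"
  shows "h \<in> left_module_hom R M N"
  using assms by (auto simp: left_module_hom_def)

text \<open>The exactness conditions from the definition of type left-\<open>FP\<^sub>n\<close>, for an arbitrary module \<open>N\<close> and
without freeness of the terms, so that resolutions can be moved between rings and between types.\<close>

definition partial_resolution ::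
    "'r ring \<Rightarrow> ('r, 'b) module \<Rightarrow> nat \<Rightarrow> (nat \<Rightarrow> ('r, 'm) module) \<Rightarrow> (nat \<Rightarrow> 'm \<Rightarrow> 'm) \<Rightarrow> ('m \<Rightarrow> 'b) \<Rightarrow> bool" where
  "partial_resolution R N n F d \<epsilon> \<longleftrightarrow>
    (\<forall>i<n. d i \<in> left_module_hom R (F (Suc i)) (F i)) \<and>
    \<epsilon> \<in> left_module_hom R (F 0) N \<and>
    \<epsilon> ` carrier (F 0) = carrier N \<and>
    (0 < n \<longrightarrow> d 0 ` carrier (F 1) = a_kernel (F 0) N \<epsilon>) \<and>
    (\<forall>i. Suc i < n \<longrightarrow> d (Suc i) ` carrier (F (Suc (Suc i))) = a_kernel (F (Suc i)) (F i) (d i))"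

lemma partial_resolution_transport:
  assumes F: "\<And>i. i \<le> n \<Longrightarrow> left_module R (F i)" and G: "\<And>i. i \<le> n \<Longrightarrow> left_module R (G i)"
    and \<psi>: "\<And>i. i \<le> n \<Longrightarrow> \<psi> i \<in> left_module_hom R (G i) (F i)"
    and bij: "\<And>i. i \<le> n \<Longrightarrow> bij_betw (\<psi> i) (carrier (G i)) (carrier (F i))"
    and res: "partial_resolution R N n F d \<epsilon>"
  shows "partial_resolution R N n G
    (\<lambda>i. inv_into (carrier (G i)) (\<psi> i) \<circ> d i \<circ> \<psi> (Suc i)) (\<epsilon> \<circ> \<psi> 0)"
proof -
  let ?\<phi> = "\<lambda>i. inv_into (carrier (G i)) (\<psi> i)"
  have \<phi>: "?\<phi> i \<in> left_module_hom R (F i) (G i)" if "i \<le> n" for i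
    using that by (intro left_module_hom_inv_into G \<psi> bij)
  have im: "\<psi> i ` carrier (G i) = carrier (F i)" if "i \<le> n" for i
    using bij[OF that] by (simp add: bij_betw_def)
  have \<phi>\<psi>: "?\<phi> i (\<psi> i x) = x" if "i \<le> n" "x \<in> carrier (G i)" for i x
    using bij[OF that(1)] that(2) by (simp add: bij_betw_def)
  have \<psi>\<phi>: "\<psi> i (?\<phi> i x) = x" if "i \<le> n" "x \<in> carrier (F i)" for i x
    using im[OF that(1)] that(2) by (simp add: f_inv_into_f)
  have \<psi>_closed: "\<psi> i x \<in> carrier (F i)" if "i \<le> n" "x \<in> carrier (G i)" for i x
    using left_module_hom_closed[OF \<psi>] that by blast
  have d: "d i \<in> left_module_hom R (F (Suc i)) (F i)" if "i < n" for i
    using res that by (simp add: partial_resolution_def)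
  have pull_back: "?\<phi> i ` {y \<in> carrier (F i). P y} = {x \<in> carrier (G i). P (\<psi> i x)}" if "i \<le> n" for i P
  proof (intro equalityI subsetI)
    fix x assume "x \<in> {x \<in> carrier (G i). P (\<psi> i x)}"
    then have "\<psi> i x \<in> {y \<in> carrier (F i). P y}" "x = ?\<phi> i (\<psi> i x)"
      using \<phi>\<psi>[OF that] \<psi>_closed[OF that] by auto
    then show "x \<in> ?\<phi> i ` {y \<in> carrier (F i). P y}" by blast
  qed (use left_module_hom_closed[OF \<phi>] \<psi>\<phi> that in auto)
  have im_d: "(?\<phi> i \<circ> d i \<circ> \<psi> (Suc i)) ` carrier (G (Suc i)) = ?\<phi> i ` d i ` carrier (F (Suc i))"
    if "i < n" for i
    using im[of "Suc i"] that by (metis Suc_leI image_comp)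
  have \<phi>_zero: "?\<phi> i y = \<zero>\<^bsub>G i\<^esub> \<longleftrightarrow> y = \<zero>\<^bsub>F i\<^esub>" if "i \<le> n" "y \<in> carrier (F i)" for i y
    using left_module_hom_zero[OF G F \<psi>] left_module_hom_zero[OF F G \<phi>] \<psi>\<phi>[OF that] that by metis
  show ?thesis
    unfolding partial_resolution_def
  proof (intro conjI allI impI)
    fix i assume "i < n"
    then show "?\<phi> i \<circ> d i \<circ> \<psi> (Suc i) \<in> left_module_hom R (G (Suc i)) (G i)"
      using d[of i] \<phi>[of i] \<psi>[of "Suc i"] by (intro left_module_hom_compose) auto
  next
    show "\<epsilon> \<circ> \<psi> 0 \<in> left_module_hom R (G 0) N"
      using res \<psi>[of 0] by (intro left_module_hom_compose) (auto simp: partial_resolution_def)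
    show "(\<epsilon> \<circ> \<psi> 0) ` carrier (G 0) = carrier N"
      using res im[of 0] unfolding partial_resolution_def by (metis image_comp le0)
  next
    assume "0 < n"
    then have "(?\<phi> 0 \<circ> d 0 \<circ> \<psi> (Suc 0)) ` carrier (G 1) = ?\<phi> 0 ` {y \<in> carrier (F 0). \<epsilon> y = \<zero>\<^bsub>N\<^esub>}"
      using im_d[of 0] res by (simp add: partial_resolution_def a_kernel_def')
    then show "(?\<phi> 0 \<circ> d 0 \<circ> \<psi> (Suc 0)) ` carrier (G 1) = a_kernel (G 0) N (\<epsilon> \<circ> \<psi> 0)"
      by (simp add: pull_back a_kernel_def')
  next
    fix i assume i: "Suc i < n"
    then have "(?\<phi> (Suc i) \<circ> d (Suc i) \<circ> \<psi> (Suc (Suc i))) ` carrier (G (Suc (Suc i))) =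
        ?\<phi> (Suc i) ` {y \<in> carrier (F (Suc i)). d i y = \<zero>\<^bsub>F i\<^esub>}"
      using im_d[of "Suc i"] res by (simp add: partial_resolution_def a_kernel_def')
    also have "\<dots> = {x \<in> carrier (G (Suc i)). d i (\<psi> (Suc i) x) = \<zero>\<^bsub>F i\<^esub>}"
      using i by (simp add: pull_back)
    also have "\<dots> = a_kernel (G (Suc i)) (G i) (?\<phi> i \<circ> d i \<circ> \<psi> (Suc i))"
      using i \<phi>_zero[of i, OF _ left_module_hom_closed[OF d \<psi>_closed]]
      unfolding a_kernel_def' comp_apply by (intro Collect_cong conj_cong refl) simp
    finally show "(?\<phi> (Suc i) \<circ> d (Suc i) \<circ> \<psi> (Suc (Suc i))) ` carrier (G (Suc (Suc i))) =
        a_kernel (G (Suc i)) (G i) (?\<phi> i \<circ> d i \<circ> \<psi> (Suc i))" .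
  qed
qed

text \<open>The terms of a resolution may live on any type: choosing bases replaces them by modules \<open>R\<^sup>k\<close>.\<close>

lemma partial_resolution_coordinates:
  assumes "ring R" and fg: "\<And>i. i \<le> n \<Longrightarrow> fg_free_left_module R (F i)"
    and res: "partial_resolution R N n F d \<epsilon>"
  obtains k :: "nat \<Rightarrow> nat" and d' \<epsilon>'
  where "partial_resolution R N n (\<lambda>i. free_left_module R {..<k i}) d' \<epsilon>'"
proof -
  interpret ring R by fact
  have "\<forall>i. \<exists>k \<psi>. i \<le> n \<longrightarrow> \<psi> \<in> left_module_hom R (free_left_module R {..<k::nat}) (F i) \<and>
      bij_betw \<psi> (carrier (free_left_module R {..<k})) (carrier (F i))"
    using fg_free_left_module_coordinates[OF fg] by blast
  then obtain k \<psi> where \<psi>: "\<And>i. i \<le> n \<Longrightarrow>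
      \<psi> i \<in> left_module_hom R (free_left_module R {..<k i::nat}) (F i) \<and>
      bij_betw (\<psi> i) (carrier (free_left_module R {..<k i})) (carrier (F i))"
    by metis
  have "left_module R (F i)" if "i \<le> n" for i
    using fg[OF that] by (simp add: fg_free_left_module_def)
  from partial_resolution_transport[OF this left_module_free conjunct1[OF \<psi>] conjunct2[OF \<psi>] res]
  show ?thesis by (rule that)
qed

lemma monoid_left_FP_alt:
  "monoid_left_FP n S \<longleftrightarrow>
    (\<exists>(F :: nat \<Rightarrow> ('s \<Rightarrow>\<^sub>0 int, nat \<Rightarrow> 's \<Rightarrow>\<^sub>0 int) module) d \<epsilon>.
      (\<forall>i\<le>n. fg_free_left_module (monoid_ring S) (F i)) \<and>
      partial_resolution (monoid_ring S) trivial_left_module n F d \<epsilon>)"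
  for S :: "'s monoid"
  unfolding monoid_left_FP_def partial_resolution_def ..

lemma monoid_left_FP_coordinates:
  assumes "monoid S" "monoid_left_FP n S"
  obtains k :: "nat \<Rightarrow> nat" and d \<epsilon>
  where "partial_resolution (monoid_ring S) trivial_left_module n
    (\<lambda>i. free_left_module (monoid_ring S) {..<k i}) d \<epsilon>"
  using assms(2) partial_resolution_coordinates[OF ring_monoid_ring[OF assms(1)]]
  unfolding monoid_left_FP_alt by metis

text \<open>Resolutions with arbitrary finite index sets suffice. This is what allows the index sets of
pairs used below.\<close>

lemma monoid_left_FP_if_resolution:
  assumes "monoid S" and fin: "\<And>i. i \<le> n \<Longrightarrow> finite (I i)"
    and "partial_resolution (monoid_ring S) trivial_left_module n
      (\<lambda>i. free_left_module (monoid_ring S) (I i)) d \<epsilon>"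
  shows "monoid_left_FP n S"
proof -
  have R: "ring (monoid_ring S)" by (rule ring_monoid_ring) fact
  have fg: "fg_free_left_module (monoid_ring S) (free_left_module (monoid_ring S) J)" if "finite J" for J :: "'j set"
    by (rule fg_free_free_left_module[OF R that]) simp
  obtain k :: "nat \<Rightarrow> nat" and d' \<epsilon>' where "partial_resolution (monoid_ring S) trivial_left_module n
      (\<lambda>i. free_left_module (monoid_ring S) {..<k i}) d' \<epsilon>'"
    using partial_resolution_coordinates[OF R fg assms(3)] fin by blast
  moreover have "fg_free_left_module (monoid_ring S) (free_left_module (monoid_ring S) {..<k i})" for i
    by (rule fg_free_free_left_module[OF R]) simp_all
  ultimately show ?thesis
    unfolding monoid_left_FP_alt
    by (intro exI[of _ "\<lambda>i. free_left_module (monoid_ring S) {..<k i}"] exI[of _ d'] exI[of _ \<epsilon>']) blast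
qed

section \<open>Passing to a direct factor of a ring\<close>

text \<open>An axiomatic form of the situation that \<open>Q\<close> is the direct factor \<open>R z\<close> of \<open>R\<close> cut out by a central
idempotent \<open>z\<close>: the maps are \<open>\<pi> r = r z\<close> and the inclusion \<open>\<iota>\<close>, and \<open>z = \<iota> \<one>\<close>. Describing \<open>z\<close> through
\<open>\<iota>\<close> avoids a subring and lets \<open>Q\<close> have an element type of its own. The two last conditions express
that \<open>\<iota>\<close> is a map of bimodules.\<close>

locale ring_retract = R: ring R + Q: ring Q for R :: "'r ring" and Q :: "'q ring" +
  fixes \<pi> :: "'r \<Rightarrow> 'q" and \<iota> :: "'q \<Rightarrow> 'r"
  assumes \<pi>_hom: "\<pi> \<in> ring_hom R Q"
    and \<iota>_closed [simp, intro]: "a \<in> carrier Q \<Longrightarrow> \<iota> a \<in> carrier R"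
    and \<iota>_add: "\<lbrakk>a \<in> carrier Q; b \<in> carrier Q\<rbrakk> \<Longrightarrow> \<iota> (a \<oplus>\<^bsub>Q\<^esub> b) = \<iota> a \<oplus>\<^bsub>R\<^esub> \<iota> b"
    and \<pi>_\<iota> [simp]: "a \<in> carrier Q \<Longrightarrow> \<pi> (\<iota> a) = a"
    and \<iota>_left: "\<lbrakk>r \<in> carrier R; a \<in> carrier Q\<rbrakk> \<Longrightarrow> \<iota> (\<pi> r \<otimes>\<^bsub>Q\<^esub> a) = r \<otimes>\<^bsub>R\<^esub> \<iota> a"
    and \<iota>_right: "\<lbrakk>r \<in> carrier R; a \<in> carrier Q\<rbrakk> \<Longrightarrow> \<iota> (a \<otimes>\<^bsub>Q\<^esub> \<pi> r) = \<iota> a \<otimes>\<^bsub>R\<^esub> r"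
begin

lemma \<pi>_closed [simp, intro]: "r \<in> carrier R \<Longrightarrow> \<pi> r \<in> carrier Q"
  and \<pi>_add [simp]: "\<lbrakk>r \<in> carrier R; s \<in> carrier R\<rbrakk> \<Longrightarrow> \<pi> (r \<oplus>\<^bsub>R\<^esub> s) = \<pi> r \<oplus>\<^bsub>Q\<^esub> \<pi> s"
  and \<pi>_mult [simp]: "\<lbrakk>r \<in> carrier R; s \<in> carrier R\<rbrakk> \<Longrightarrow> \<pi> (r \<otimes>\<^bsub>R\<^esub> s) = \<pi> r \<otimes>\<^bsub>Q\<^esub> \<pi> s"
  using \<pi>_hom by (auto simp: ring_hom_def)

lemma \<pi>_zero [simp]: "\<pi> \<zero>\<^bsub>R\<^esub> = \<zero>\<^bsub>Q\<^esub>"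
  using \<pi>_add[of "\<zero>\<^bsub>R\<^esub>" "\<zero>\<^bsub>R\<^esub>"] by (simp add: Q.add.r_cancel_one del: \<pi>_add)

lemma \<iota>_zero [simp]: "\<iota> \<zero>\<^bsub>Q\<^esub> = \<zero>\<^bsub>R\<^esub>"
  using \<iota>_add[of "\<zero>\<^bsub>Q\<^esub>" "\<zero>\<^bsub>Q\<^esub>"] by (simp add: R.add.r_cancel_one)

lemma \<iota>_mult: "\<lbrakk>a \<in> carrier Q; b \<in> carrier Q\<rbrakk> \<Longrightarrow> \<iota> (a \<otimes>\<^bsub>Q\<^esub> b) = \<iota> a \<otimes>\<^bsub>R\<^esub> \<iota> b"
  using \<iota>_left[of "\<iota> a" b] by simp

lemma \<iota>_\<pi>: "r \<in> carrier R \<Longrightarrow> \<iota> (\<pi> r) = \<iota> \<one>\<^bsub>Q\<^esub> \<otimes>\<^bsub>R\<^esub> r"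
  using \<iota>_right[of r "\<one>\<^bsub>Q\<^esub>"] by simp

lemma \<pi>_a_inv [simp]: "r \<in> carrier R \<Longrightarrow> \<pi> (\<ominus>\<^bsub>R\<^esub> r) = \<ominus>\<^bsub>Q\<^esub> \<pi> r"
  using \<pi>_add[of "\<ominus>\<^bsub>R\<^esub> r" r] by (simp add: R.l_neg Q.minus_equality del: \<pi>_add)

text \<open>The component \<open>r (1 - z)\<close> of \<open>r\<close> in the complementary factor.\<close>

definition compl_part :: "'r \<Rightarrow> 'r" where
  "compl_part r = r \<ominus>\<^bsub>R\<^esub> \<iota> (\<pi> r)"

lemma compl_part_closed [simp, intro]: "r \<in> carrier R \<Longrightarrow> compl_part r \<in> carrier R"
  by (simp add: compl_part_def)

lemma compl_part_zero [simp]: "compl_part \<zero>\<^bsub>R\<^esub> = \<zero>\<^bsub>R\<^esub>"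
  by (simp add: compl_part_def R.minus_eq)

lemma compl_part_add: "\<lbrakk>r \<in> carrier R; s \<in> carrier R\<rbrakk> \<Longrightarrow> compl_part (r \<oplus>\<^bsub>R\<^esub> s) = compl_part r \<oplus>\<^bsub>R\<^esub> compl_part s"
  by (simp add: compl_part_def \<iota>_add R.minus_eq R.minus_add R.a_ac)

lemma compl_part_mult: "\<lbrakk>r \<in> carrier R; s \<in> carrier R\<rbrakk> \<Longrightarrow> compl_part (r \<otimes>\<^bsub>R\<^esub> s) = r \<otimes>\<^bsub>R\<^esub> compl_part s"
  by (simp add: compl_part_def \<iota>_left R.minus_eq R.r_distr R.r_minus)

lemma \<pi>_compl_part [simp]: "r \<in> carrier R \<Longrightarrow> \<pi> (compl_part r) = \<zero>\<^bsub>Q\<^esub>"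
  by (simp add: compl_part_def R.minus_eq Q.r_neg)

lemma compl_part_\<iota> [simp]: "a \<in> carrier Q \<Longrightarrow> compl_part (\<iota> a) = \<zero>\<^bsub>R\<^esub>"
  by (simp add: compl_part_def R.minus_eq R.r_neg)

lemma compl_part_compl_part [simp]: "r \<in> carrier R \<Longrightarrow> compl_part (compl_part r) = compl_part r"
  by (simp add: compl_part_def[of "compl_part r"] R.minus_eq)

lemma retract_decomposition: "r \<in> carrier R \<Longrightarrow> \<iota> (\<pi> r) \<oplus>\<^bsub>R\<^esub> compl_part r = r"
  by (simp add: compl_part_def R.minus_eq) (metis R.add.inv_solve_right' R.a_comm R.add.inv_closed R.add.m_closed \<iota>_closed \<pi>_closed)

lemma \<pi>_coords: "x \<in> carrier (free_left_module R I) \<Longrightarrow> (\<lambda>i. \<pi> (x i)) \<in> carrier (free_left_module Q I)"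
  and \<iota>_coords: "y \<in> carrier (free_left_module Q I) \<Longrightarrow> (\<lambda>i. \<iota> (y i)) \<in> carrier (free_left_module R I)"
  by (auto simp: carrier_free_left_module)

end

text \<open>The module \<open>N\<close> is \<open>N'\<close> with scalars restricted along \<open>\<pi>\<close>; equivalently, \<open>z\<close> acts on it
as the identity.\<close>

locale ring_retract_modules = ring_retract R Q \<pi> \<iota> +
  N: left_module R N + N': left_module Q N'
  for R :: "'r ring" and Q :: "'q ring" and \<pi> \<iota>
    and N :: "('r, 'c) module" and N' :: "('q, 'c) module" +
  assumes carrier_eq: "carrier N' = carrier N" and zero_eq: "\<zero>\<^bsub>N'\<^esub> = \<zero>\<^bsub>N\<^esub>"
    and add_eq: "\<lbrakk>x \<in> carrier N; y \<in> carrier N\<rbrakk> \<Longrightarrow> x \<oplus>\<^bsub>N'\<^esub> y = x \<oplus>\<^bsub>N\<^esub> y"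
    and smult_eq: "\<lbrakk>r \<in> carrier R; x \<in> carrier N\<rbrakk> \<Longrightarrow> r \<odot>\<^bsub>N\<^esub> x = \<pi> r \<odot>\<^bsub>N'\<^esub> x"
begin

text \<open>The complex over \<open>Q\<close> is \<open>z F\<close>, in coordinates. Exactness survives because \<open>d\<close> is linear, hence commutes
with multiplication by \<open>z\<close>: a cycle with coordinates in \<open>R z\<close> that is a boundary \<open>d x\<close> is also the
boundary \<open>d (z x)\<close>. Surjectivity onto \<open>N\<close> uses that \<open>z\<close> acts as the identity there.\<close>

lemma partial_resolution_descend:
  assumes res: "partial_resolution R N n (\<lambda>i. free_left_module R (I i)) d \<epsilon>"
  shows "partial_resolution Q N' n (\<lambda>i. free_left_module Q (I i))
    (\<lambda>i y l. \<pi> (d i (\<lambda>k. \<iota> (y k)) l)) (\<lambda>y. \<epsilon> (\<lambda>k. \<iota> (y k)))"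
proof -
  let ?F = "\<lambda>i. free_left_module R (I i)" and ?G = "\<lambda>i. free_left_module Q (I i)"
  let ?d = "\<lambda>i y l. \<pi> (d i (\<lambda>k. \<iota> (y k)) l)" and ?\<epsilon> = "\<lambda>y. \<epsilon> (\<lambda>k. \<iota> (y k))"
  let ?z = "\<iota> \<one>\<^bsub>Q\<^esub>"
  have d: "d i \<in> left_module_hom R (?F (Suc i)) (?F i)" if "i < n" for i
    using res that by (simp add: partial_resolution_def)
  have \<epsilon>: "\<epsilon> \<in> left_module_hom R (?F 0) N" and \<epsilon>_im: "\<epsilon> ` carrier (?F 0) = carrier N"
    using res by (simp_all add: partial_resolution_def)
  have d_closed: "d i x \<in> carrier (?F i)" if "i < n" "x \<in> carrier (?F (Suc i))" for i x
    using left_module_hom_closed[OF d] that by blast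
  \<comment> \<open>The composition of \<open>\<pi>\<close> and \<open>\<iota>\<close> is the scalar \<open>z\<close>, with which linear maps commute.\<close>
  have project: "(\<lambda>k. \<iota> (\<pi> (x k))) = ?z \<odot>\<^bsub>free_left_module R J\<^esub> x"
    if "x \<in> carrier (free_left_module R J)" for x and J :: "'d set"
    using R.free_left_module_coord_closed[OF that] by (simp add: \<iota>_\<pi>)
  have d_project: "d i (\<lambda>k. \<iota> (\<pi> (x k))) = (\<lambda>l. \<iota> (\<pi> (d i x l)))" if "i < n" "x \<in> carrier (?F (Suc i))" for i x
    using left_module_hom_smult[OF d[OF that(1)] \<iota>_closed[OF Q.one_closed] that(2)]
    by (simp only: project[OF that(2)] project[OF d_closed[OF that]])
  have \<epsilon>_project: "\<epsilon> (\<lambda>k. \<iota> (\<pi> (x k))) = \<epsilon> x" if "x \<in> carrier (?F 0)" for x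
    using left_module_hom_smult[OF \<epsilon> \<iota>_closed[OF Q.one_closed] that] left_module_hom_closed[OF \<epsilon> that]
      N'.smult_one[of "\<epsilon> x"]
    by (simp add: project[OF that] smult_eq carrier_eq del: free_left_module_simps)
  have d_coords: "(\<lambda>l. \<iota> (?d i y l)) = d i (\<lambda>k. \<iota> (y k))" if "i < n" "y \<in> carrier (?G (Suc i))" for i y
    using d_project[OF that(1) \<iota>_coords[OF that(2)]] Q.free_left_module_coord_closed[OF that(2)] by simp
  have d_\<pi>: "?d i (\<lambda>k. \<pi> (x k)) = (\<lambda>l. \<pi> (d i x l))" if "i < n" "x \<in> carrier (?F (Suc i))" for i x
    using d_project[OF that] R.free_left_module_coord_closed[OF d_closed[OF that]] by simp
  have zero_iff: "(\<lambda>l. \<pi> (x l)) = \<zero>\<^bsub>free_left_module Q J\<^esub> \<longleftrightarrow>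
      (\<lambda>l. \<iota> (\<pi> (x l))) = \<zero>\<^bsub>free_left_module R J\<^esub>" if "x \<in> carrier (free_left_module R J)" for x and J :: "'d set"
    using R.free_left_module_coord_closed[OF that] by (auto simp: fun_eq_iff) (metis \<pi>_\<iota> \<pi>_closed \<pi>_zero)
  show ?thesis
    unfolding partial_resolution_def
  proof (intro conjI allI impI)
    fix i assume i: "i < n"
    show "?d i \<in> left_module_hom Q (?G (Suc i)) (?G i)"
    proof (rule left_module_homI)
      fix y assume "y \<in> carrier (?G (Suc i))"
      then show "?d i y \<in> carrier (?G i)" by (intro \<pi>_coords d_closed i \<iota>_coords)
    next
      fix x y assume xy: "x \<in> carrier (?G (Suc i))" "y \<in> carrier (?G (Suc i))"
      note c = this[THEN Q.free_left_module_coord_closed]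
      show "?d i (x \<oplus>\<^bsub>?G (Suc i)\<^esub> y) = ?d i x \<oplus>\<^bsub>?G i\<^esub> ?d i y"
        using left_module_hom_add[OF d[OF i] xy[THEN \<iota>_coords]]
          xy[THEN \<iota>_coords, THEN d_closed[OF i], THEN R.free_left_module_coord_closed]
        by (simp add: \<iota>_add c)
    next
      fix r y assume ry: "r \<in> carrier Q" "y \<in> carrier (?G (Suc i))"
      note c = ry(2)[THEN Q.free_left_module_coord_closed]
      show "?d i (r \<odot>\<^bsub>?G (Suc i)\<^esub> y) = r \<odot>\<^bsub>?G i\<^esub> ?d i y"
        using left_module_hom_smult[OF d[OF i] \<iota>_closed[OF ry(1)] \<iota>_coords[OF ry(2)]]
          ry(2)[THEN \<iota>_coords, THEN d_closed[OF i], THEN R.free_left_module_coord_closed]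
        by (simp add: \<iota>_mult c ry(1))
    qed
  next
    show "?\<epsilon> \<in> left_module_hom Q (?G 0) N'"
    proof (rule left_module_homI)
      fix y assume "y \<in> carrier (?G 0)"
      then show "?\<epsilon> y \<in> carrier N'"
        using left_module_hom_closed[OF \<epsilon> \<iota>_coords] by (simp add: carrier_eq)
    next
      fix x y assume xy: "x \<in> carrier (?G 0)" "y \<in> carrier (?G 0)"
      note c = this[THEN Q.free_left_module_coord_closed]
      show "?\<epsilon> (x \<oplus>\<^bsub>?G 0\<^esub> y) = ?\<epsilon> x \<oplus>\<^bsub>N'\<^esub> ?\<epsilon> y"
        using left_module_hom_add[OF \<epsilon> xy[THEN \<iota>_coords]] xy[THEN \<iota>_coords, THEN left_module_hom_closed[OF \<epsilon>]]
        by (simp add: \<iota>_add c add_eq)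
    next
      fix r y assume ry: "r \<in> carrier Q" "y \<in> carrier (?G 0)"
      note c = ry(2)[THEN Q.free_left_module_coord_closed]
      show "?\<epsilon> (r \<odot>\<^bsub>?G 0\<^esub> y) = r \<odot>\<^bsub>N'\<^esub> ?\<epsilon> y"
        using left_module_hom_smult[OF \<epsilon> \<iota>_closed[OF ry(1)] \<iota>_coords[OF ry(2)]]
          left_module_hom_closed[OF \<epsilon> \<iota>_coords[OF ry(2)]]
        by (simp add: \<iota>_mult c ry(1) smult_eq)
    qed
  next
    have "\<epsilon> x \<in> ?\<epsilon> ` carrier (?G 0)" if "x \<in> carrier (?F 0)" for x
      using \<epsilon>_project[OF that] \<pi>_coords[OF that] by (metis image_eqI)
    then show "?\<epsilon> ` carrier (?G 0) = carrier N'"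
      unfolding carrier_eq \<epsilon>_im[symmetric] using \<iota>_coords by blast
  next
    assume n: "0 < n"
    then have ex: "d 0 ` carrier (?F 1) = a_kernel (?F 0) N \<epsilon>"
      using res by (simp add: partial_resolution_def)
    show "?d 0 ` carrier (?G 1) = a_kernel (?G 0) N' ?\<epsilon>"
    proof (intro equalityI subsetI)
      fix y assume "y \<in> ?d 0 ` carrier (?G 1)"
      then obtain v where v: "v \<in> carrier (?G 1)" "y = ?d 0 v" by blast
      have "d 0 (\<lambda>k. \<iota> (v k)) \<in> a_kernel (?F 0) N \<epsilon>"
        using \<iota>_coords[OF v(1)] by (simp flip: ex)
      then show "y \<in> a_kernel (?G 0) N' ?\<epsilon>"
        using v d_coords[OF n, of v] by (auto simp: a_kernel_def' zero_eq intro!: \<pi>_coords)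
    next
      fix y assume y: "y \<in> a_kernel (?G 0) N' ?\<epsilon>"
      then have "(\<lambda>k. \<iota> (y k)) \<in> d 0 ` carrier (?F 1)"
        unfolding ex using \<iota>_coords by (auto simp: a_kernel_def' zero_eq)
      then obtain x where x: "x \<in> carrier (?F 1)" "(\<lambda>k. \<iota> (y k)) = d 0 x" by blast
      have "y \<in> carrier (?G 0)" using y by (simp add: a_kernel_def')
      then have "y = (\<lambda>k. \<pi> (d 0 x k))"
        using Q.free_left_module_coord_closed[of y "I 0"] by (simp flip: x(2))
      also have "\<dots> = ?d 0 (\<lambda>k. \<pi> (x k))"
        using d_\<pi>[OF n, of x] x(1) by simp
      finally show "y \<in> ?d 0 ` carrier (?G 1)" 
        by (rule image_eqI[where x = "\<lambda>k. \<pi> (x k)"]) (rule \<pi>_coords[OF x(1)])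
    qed
  next
    fix i assume n: "Suc i < n"
    then have ex: "d (Suc i) ` carrier (?F (Suc (Suc i))) = a_kernel (?F (Suc i)) (?F i) (d i)"
      using res by (simp add: partial_resolution_def)
    have i: "i < n" using n by simp
    show "?d (Suc i) ` carrier (?G (Suc (Suc i))) = a_kernel (?G (Suc i)) (?G i) (?d i)"
    proof (intro equalityI subsetI)
      fix y assume "y \<in> ?d (Suc i) ` carrier (?G (Suc (Suc i)))"
      then obtain v where v: "v \<in> carrier (?G (Suc (Suc i)))" "y = ?d (Suc i) v" by blast
      have "d (Suc i) (\<lambda>k. \<iota> (v k)) \<in> a_kernel (?F (Suc i)) (?F i) (d i)"
        using \<iota>_coords[OF v(1)] by (simp flip: ex)
      then show "y \<in> a_kernel (?G (Suc i)) (?G i) (?d i)"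
        using v d_coords[OF n, of v] by (auto simp: a_kernel_def' intro!: \<pi>_coords)
    next
      fix y assume y: "y \<in> a_kernel (?G (Suc i)) (?G i) (?d i)"
      then have yc: "y \<in> carrier (?G (Suc i))" and "?d i y = \<zero>\<^bsub>?G i\<^esub>" by (auto simp: a_kernel_def')
      then have "d i (\<lambda>k. \<iota> (y k)) = \<zero>\<^bsub>?F i\<^esub>"
        using zero_iff[OF d_closed[OF i \<iota>_coords[OF yc]]] d_coords[OF i yc] by simp
      then have "(\<lambda>k. \<iota> (y k)) \<in> d (Suc i) ` carrier (?F (Suc (Suc i)))"
        unfolding ex using \<iota>_coords[OF yc] by (auto simp: a_kernel_def')
      then obtain x where x: "x \<in> carrier (?F (Suc (Suc i)))" "(\<lambda>k. \<iota> (y k)) = d (Suc i) x" by blast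
      have "y = (\<lambda>k. \<pi> (d (Suc i) x k))"
        using Q.free_left_module_coord_closed[OF yc] by (simp flip: x(2))
      also have "\<dots> = ?d (Suc i) (\<lambda>k. \<pi> (x k))"
        using d_\<pi>[OF n x(1)] by simp
      finally show "y \<in> ?d (Suc i) ` carrier (?G (Suc (Suc i)))" 
        by (rule image_eqI[where x = "\<lambda>k. \<pi> (x k)"]) (rule \<pi>_coords[OF x(1)])
    qed
  qed
qed

end

section \<open>Extending a resolution from a direct factor\<close>

context ring_retract
begin

text \<open>The index set of \<open>G\<^sub>i\<close>, the term in degree \<open>i\<close> of the padded resolution: it is the union of copies of
the index sets of \<open>F\<^sub>0, \<dots>, F\<^sub>i\<close>, and the copy of that of \<open>F\<^sub>j\<close> is called level \<open>j\<close>. This choice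
solves the following problem. Over \<open>R z\<close> the term must be \<open>F\<^sub>i\<close> plus a summand shared with degree
\<open>i + 1\<close> and one shared with degree \<open>i - 1\<close>; over \<open>R (1 - z)\<close> it must consist of two such shared
summands only; and the two ranks must agree. Over \<open>R z\<close>, degree \<open>i\<close> shares the levels \<open>j < i\<close> with
\<open>i - j\<close> odd with degree \<open>i + 1\<close>, and those with \<open>i - j > 0\<close> even with degree \<open>i - 1\<close>. Over \<open>R (1 - z)\<close> the
parities are reversed: the levels with \<open>i - j\<close> even, now including \<open>j = i\<close>, are shared with degree
\<open>i + 1\<close> and the others with degree \<open>i - 1\<close>.\<close>

definition pad_index :: "(nat \<Rightarrow> 'k set) \<Rightarrow> nat \<Rightarrow> (nat \<times> 'k) set" where
  "pad_index K i = Sigma {..i} K"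

text \<open>The differential from degree \<open>i + 1\<close> to degree \<open>i\<close>, where \<open>h\<close> is the differential of the resolution over \<open>Q\<close>.
It projects each level to the factor over which the two degrees share it, and it applies \<open>h\<close> to the
component of level \<open>i + 1\<close> in \<open>R z\<close>. Level \<open>i\<close> is a target of both.\<close>

definition pad_map ::
    "nat \<Rightarrow> (('k \<Rightarrow> 'q) \<Rightarrow> 'k \<Rightarrow> 'q) \<Rightarrow> (nat \<times> 'k \<Rightarrow> 'r) \<Rightarrow> nat \<times> 'k \<Rightarrow> 'r" where
  "pad_map i h x = (\<lambda>(j, l).
     if i < j then \<zero>\<^bsub>R\<^esub>
     else if j = i then \<iota> (h (\<lambda>k. \<pi> (x (Suc i, k))) l) \<oplus>\<^bsub>R\<^esub> compl_part (x (i, l))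
     else if even (i - j) then compl_part (x (j, l))
     else \<iota> (\<pi> (x (j, l))))"

lemma finite_pad_index: "(\<And>j. j \<le> i \<Longrightarrow> finite (K j)) \<Longrightarrow> finite (pad_index K i)"
  by (auto simp: pad_index_def)

lemma carrier_pad_indexI:
  assumes "\<And>j l. \<lbrakk>j \<le> i; l \<in> K j\<rbrakk> \<Longrightarrow> x (j, l) \<in> carrier R"
    and "\<And>j l. \<not> (j \<le> i \<and> l \<in> K j) \<Longrightarrow> x (j, l) = \<zero>\<^bsub>R\<^esub>"
  shows "x \<in> carrier (free_left_module R (pad_index K i))"
  unfolding carrier_free_left_module
proof (intro conjI ballI allI impI)
  fix p assume "p \<in> pad_index K i"
  then show "x p \<in> carrier R"
    using assms(1)[of "fst p" "snd p"] by (cases p) (simp add: pad_index_def)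
next
  fix p assume "p \<notin> pad_index K i"
  then show "x p = \<zero>\<^bsub>R\<^esub>"
    using assms(2)[of "fst p" "snd p"] by (cases p) (simp add: pad_index_def)
qed

lemma zero_off_pad_index:
  "\<lbrakk>x \<in> carrier (free_left_module R (pad_index K i)); \<not> (j \<le> i \<and> l \<in> K j)\<rbrakk> \<Longrightarrow> x (j, l) = \<zero>\<^bsub>R\<^esub>"
  by (simp add: carrier_free_left_module pad_index_def)

lemma top_coords: "x \<in> carrier (free_left_module R (pad_index K i)) \<Longrightarrow>
    (\<lambda>k. \<pi> (x (i, k))) \<in> carrier (free_left_module Q (K i))"
  by (auto simp: carrier_free_left_module pad_index_def)

lemma pad_map_closed:
  assumes "h \<in> left_module_hom Q (free_left_module Q (K (Suc i))) (free_left_module Q (K i))"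
    and "x \<in> carrier (free_left_module R (pad_index K (Suc i)))"
  shows "pad_map i h x \<in> carrier (free_left_module R (pad_index K i))"
proof -
  let ?v = "h (\<lambda>k. \<pi> (x (Suc i, k)))"
  note xc = R.free_left_module_coord_closed[OF assms(2)]
  have v: "?v \<in> carrier (free_left_module Q (K i))"
    by (rule left_module_hom_closed[OF assms(1) top_coords[OF assms(2)]])
  note vc = Q.free_left_module_coord_closed[OF v]
  show ?thesis
  proof (rule carrier_pad_indexI)
    fix j l
    show "pad_map i h x (j, l) \<in> carrier R"
      using xc vc by (simp add: pad_map_def)
    show "pad_map i h x (j, l) = \<zero>\<^bsub>R\<^esub>" if *: "\<not> (j \<le> i \<and> l \<in> K j)"
    proof (cases "i < j")
      case False
      with * have "l \<notin> K j" by simp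
      then have "x (j, l) = \<zero>\<^bsub>R\<^esub>" "j = i \<Longrightarrow> ?v l = \<zero>\<^bsub>Q\<^esub>"
        using zero_off_pad_index[OF assms(2)] v by (auto simp: carrier_free_left_module)
      then show ?thesis by (auto simp: pad_map_def)
    qed (simp add: pad_map_def)
  qed
qed

lemma pad_map_hom:
  assumes h: "h \<in> left_module_hom Q (free_left_module Q (K (Suc i))) (free_left_module Q (K i))"
  shows "pad_map i h \<in> left_module_hom R (free_left_module R (pad_index K (Suc i)))
    (free_left_module R (pad_index K i))"
    (is "_ \<in> left_module_hom R ?F ?G")
proof (rule left_module_homI)
  fix x y assume xy: "x \<in> carrier ?F" "y \<in> carrier ?F"
  let ?x = "\<lambda>k. \<pi> (x (Suc i, k))" and ?y = "\<lambda>k. \<pi> (y (Suc i, k))"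
  have "h (\<lambda>k. ?x k \<oplus>\<^bsub>Q\<^esub> ?y k) = (\<lambda>l. h ?x l \<oplus>\<^bsub>Q\<^esub> h ?y l)"
    using left_module_hom_add[OF h xy[THEN top_coords]] by simp
  moreover have "h ?x l \<in> carrier Q" "h ?y l \<in> carrier Q" for l
    using xy[THEN top_coords, THEN left_module_hom_closed[OF h], THEN Q.free_left_module_coord_closed] by auto
  ultimately show "pad_map i h (x \<oplus>\<^bsub>?F\<^esub> y) = pad_map i h x \<oplus>\<^bsub>?G\<^esub> pad_map i h y"
    using xy[THEN R.free_left_module_coord_closed]
    by (intro ext) (simp add: pad_map_def \<iota>_add compl_part_add R.a_ac split: prod.split)
next
  fix r x assume r: "r \<in> carrier R" and x: "x \<in> carrier ?F"
  let ?x = "\<lambda>k. \<pi> (x (Suc i, k))"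
  have "h (\<lambda>k. \<pi> r \<otimes>\<^bsub>Q\<^esub> ?x k) = (\<lambda>l. \<pi> r \<otimes>\<^bsub>Q\<^esub> h ?x l)"
    using left_module_hom_smult[OF h \<pi>_closed[OF r] top_coords[OF x]] by simp
  moreover have "h ?x l \<in> carrier Q" for l
    using x[THEN top_coords, THEN left_module_hom_closed[OF h], THEN Q.free_left_module_coord_closed] by auto
  ultimately show "pad_map i h (r \<odot>\<^bsub>?F\<^esub> x) = r \<odot>\<^bsub>?G\<^esub> pad_map i h x"
    using R.free_left_module_coord_closed[OF x] r
    by (intro ext) (simp add: pad_map_def \<iota>_left compl_part_mult R.r_distr split: prod.split)
qed (rule pad_map_closed[OF h])

lemma pad_map_top:
  assumes "x \<in> carrier (free_left_module R (pad_index K (Suc i)))"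
    and "h \<in> left_module_hom Q (free_left_module Q (K (Suc i))) (free_left_module Q (K i))"
  shows "\<pi> (pad_map i h x (i, l)) = h (\<lambda>k. \<pi> (x (Suc i, k))) l"
  using R.free_left_module_coord_closed[OF assms(1)]
    Q.free_left_module_coord_closed[OF left_module_hom_closed[OF assms(2) top_coords[OF assms(1)]]]
  by (simp add: pad_map_def)

text \<open>The criterion for boundaries. Besides the condition on the top level, which comes from \<open>F\<close>, the
remaining levels must already lie in the factors to which the differential projects; then
\<open>x\<close> lifts to itself on all levels up to \<open>i\<close>.\<close>

lemma pad_map_lift:
  assumes h: "h \<in> left_module_hom Q (free_left_module Q (K (Suc i))) (free_left_module Q (K i))"
    and x: "x \<in> carrier (free_left_module R (pad_index K i))"
    and v: "v \<in> carrier (free_left_module Q (K (Suc i)))" "h v = (\<lambda>k. \<pi> (x (i, k)))"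
    and even: "\<And>j l. \<lbrakk>j < i; even (i - j)\<rbrakk> \<Longrightarrow> \<pi> (x (j, l)) = \<zero>\<^bsub>Q\<^esub>"
    and odd: "\<And>j l. \<lbrakk>j < i; odd (i - j)\<rbrakk> \<Longrightarrow> compl_part (x (j, l)) = \<zero>\<^bsub>R\<^esub>"
  shows "x \<in> pad_map i h ` carrier (free_left_module R (pad_index K (Suc i)))"
proof
  let ?y = "\<lambda>(j, l). if j = Suc i then \<iota> (v l) else x (j, l)"
  show "?y \<in> carrier (free_left_module R (pad_index K (Suc i)))"
  proof (rule carrier_pad_indexI)
    fix j l
    show "?y (j, l) \<in> carrier R"
      using R.free_left_module_coord_closed[OF x] Q.free_left_module_coord_closed[OF v(1)] by simp
    show "?y (j, l) = \<zero>\<^bsub>R\<^esub>" if "\<not> (j \<le> Suc i \<and> l \<in> K j)"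
    proof (cases "j = Suc i")
      case True
      with that v(1) show ?thesis by (simp add: carrier_free_left_module)
    next
      case False
      with that zero_off_pad_index[OF x, of j l] show ?thesis by auto
    qed
  qed
  have top: "(\<lambda>k. \<pi> (?y (Suc i, k))) = v"
    using Q.free_left_module_coord_closed[OF v(1)] by simp
  note xc = R.free_left_module_coord_closed[OF x]
  have e: "compl_part (x (j, l)) = x (j, l)" if "j < i" "even (i - j)" for j l
    using retract_decomposition[OF xc, of "(j, l)"] xc even[OF that] by simp
  have o: "\<iota> (\<pi> (x (j, l))) = x (j, l)" if "j < i" "odd (i - j)" for j l
    using retract_decomposition[OF xc, of "(j, l)"] xc odd[OF that] by simp
  show "x = pad_map i h ?y"
  proof
    fix p
    show "x p = pad_map i h ?y p"
    proof (cases p)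
      case (Pair j l)
      consider "i < j" | "j = i" | "j < i" by linarith
      then show ?thesis
      proof cases
        case 1
        then show ?thesis using zero_off_pad_index[OF x] by (simp add: Pair pad_map_def)
      next
        case 2
        then show ?thesis
          using retract_decomposition[OF xc] v(2) by (simp add: Pair pad_map_def top[simplified])
      next
        case 3
        then show ?thesis by (simp add: Pair pad_map_def e o)
      qed
    qed
  qed
qed

end

context ring_retract_modules
begin

text \<open>Cycles and boundaries agree level by level: at the top over \<open>R z\<close> by exactness of the given
resolution, and elsewhere because the differential is complementary to the preceding one, projecting
each level to \<open>R z\<close> in one degree and to \<open>R (1 - z)\<close> in the next.\<close>

lemma partial_resolution_ascend:
  assumes res: "partial_resolution Q N' n (\<lambda>i. free_left_module Q (K i)) D \<eta>"
  shows "partial_resolution R N n (\<lambda>i. free_left_module R (pad_index K i))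
    (\<lambda>i. pad_map i (D i)) (\<lambda>x. \<eta> (\<lambda>k. \<pi> (x (0, k))))"
proof -
  let ?F = "\<lambda>i. free_left_module Q (K i)" and ?G = "\<lambda>i. free_left_module R (pad_index K i)"
  let ?\<epsilon> = "\<lambda>x. \<eta> (\<lambda>k. \<pi> (x (0::nat, k)))"
  have D: "D i \<in> left_module_hom Q (?F (Suc i)) (?F i)" if "i < n" for i
    using res that by (simp add: partial_resolution_def)
  have \<eta>: "\<eta> \<in> left_module_hom Q (?F 0) N'" and \<eta>_im: "\<eta> ` carrier (?F 0) = carrier N'"
    using res by (simp_all add: partial_resolution_def)
  have top_pad: "(\<lambda>k. \<pi> (pad_map i (D i) x (i, k))) = D i (\<lambda>k. \<pi> (x (Suc i, k)))"
    if "i < n" "x \<in> carrier (?G (Suc i))" for i x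
    using pad_map_top[OF that(2) D[OF that(1)]] by blast
  show ?thesis
    unfolding partial_resolution_def
  proof (intro conjI allI impI)
    fix i assume "i < n"
    then show "pad_map i (D i) \<in> left_module_hom R (?G (Suc i)) (?G i)"
      by (intro pad_map_hom D)
  next
    show "?\<epsilon> \<in> left_module_hom R (?G 0) N"
    proof (rule left_module_homI)
      fix x assume "x \<in> carrier (?G 0)"
      then show "?\<epsilon> x \<in> carrier N"
        using left_module_hom_closed[OF \<eta> top_coords[where K = K and i = 0]] by (simp add: carrier_eq)
    next
      fix x y assume xy: "x \<in> carrier (?G 0)" "y \<in> carrier (?G 0)"
      then show "?\<epsilon> (x \<oplus>\<^bsub>?G 0\<^esub> y) = ?\<epsilon> x \<oplus>\<^bsub>N\<^esub> ?\<epsilon> y"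
        using left_module_hom_add[OF \<eta> xy[THEN top_coords]] xy[THEN R.free_left_module_coord_closed]
          xy[THEN top_coords, THEN left_module_hom_closed[OF \<eta>]]
        by (simp add: add_eq carrier_eq)
    next
      fix r x assume r: "r \<in> carrier R" and x: "x \<in> carrier (?G 0)"
      then show "?\<epsilon> (r \<odot>\<^bsub>?G 0\<^esub> x) = r \<odot>\<^bsub>N\<^esub> ?\<epsilon> x"
        using left_module_hom_smult[OF \<eta> \<pi>_closed[OF r] top_coords[OF x]]
          R.free_left_module_coord_closed[OF x] left_module_hom_closed[OF \<eta> top_coords[OF x]]
        by (simp add: smult_eq carrier_eq)
    qed
  next
    have "\<eta> y \<in> ?\<epsilon> ` carrier (?G 0)" if y: "y \<in> carrier (?F 0)" for y
    proof
      let ?x = "\<lambda>(j, k). if j = (0::nat) then \<iota> (y k) else \<zero>\<^bsub>R\<^esub>"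
      show "?x \<in> carrier (?G 0)"
        using y by (intro carrier_pad_indexI) (auto simp: carrier_free_left_module)
      show "\<eta> y = ?\<epsilon> ?x"
        using Q.free_left_module_coord_closed[OF y] by simp
    qed
    then show "?\<epsilon> ` carrier (?G 0) = carrier N"
      unfolding carrier_eq[symmetric] \<eta>_im[symmetric] using top_coords[where K = K and i = 0] by blast
  next
    assume n: "0 < n"
    then have ex: "D 0 ` carrier (?F 1) = a_kernel (?F 0) N' \<eta>"
      using res by (simp add: partial_resolution_def)
    show "pad_map 0 (D 0) ` carrier (?G 1) = a_kernel (?G 0) N ?\<epsilon>"
    proof (intro equalityI subsetI)
      fix x assume "x \<in> pad_map 0 (D 0) ` carrier (?G 1)"
      then obtain y where y: "y \<in> carrier (?G (Suc 0))" "x = pad_map 0 (D 0) y" by auto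
      have "D 0 (\<lambda>k. \<pi> (y (Suc 0, k))) \<in> a_kernel (?F 0) N' \<eta>"
        using top_coords[OF y(1)] by (simp flip: ex)
      then show "x \<in> a_kernel (?G 0) N ?\<epsilon>"
        using pad_map_closed[OF D[OF n] y(1)] top_pad[OF n y(1)]
        by (simp add: a_kernel_def' y(2) zero_eq)
    next
      fix x assume "x \<in> a_kernel (?G 0) N ?\<epsilon>"
      then have x: "x \<in> carrier (?G 0)" "?\<epsilon> x = \<zero>\<^bsub>N\<^esub>" by (auto simp: a_kernel_def')
      then have "(\<lambda>k. \<pi> (x (0, k))) \<in> D 0 ` carrier (?F 1)"
        unfolding ex using top_coords[OF x(1)] by (simp add: a_kernel_def' zero_eq)
      then obtain v where "v \<in> carrier (?F (Suc 0))" "D 0 v = (\<lambda>k. \<pi> (x (0, k)))" by auto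
      then show "x \<in> pad_map 0 (D 0) ` carrier (?G 1)"
        using pad_map_lift[OF D[OF n] x(1)] by simp
    qed
  next
    fix i assume n: "Suc i < n"
    then have ex: "D (Suc i) ` carrier (?F (Suc (Suc i))) = a_kernel (?F (Suc i)) (?F i) (D i)"
      using res by (simp add: partial_resolution_def)
    have i: "i < n" using n by simp
    show "pad_map (Suc i) (D (Suc i)) ` carrier (?G (Suc (Suc i))) = a_kernel (?G (Suc i)) (?G i) (pad_map i (D i))"
    proof (intro equalityI subsetI)
      fix x assume "x \<in> pad_map (Suc i) (D (Suc i)) ` carrier (?G (Suc (Suc i)))"
      then obtain y where y: "y \<in> carrier (?G (Suc (Suc i)))" and x_def: "x = pad_map (Suc i) (D (Suc i)) y" by auto
      have x: "x \<in> carrier (?G (Suc i))"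
        unfolding x_def by (rule pad_map_closed[OF D[OF n] y])
      have "D (Suc i) (\<lambda>k. \<pi> (y (Suc (Suc i), k))) \<in> a_kernel (?F (Suc i)) (?F i) (D i)"
        using top_coords[OF y] by (simp flip: ex)
      then have "D i (\<lambda>k. \<pi> (x (Suc i, k))) = (\<lambda>_. \<zero>\<^bsub>Q\<^esub>)"
        unfolding x_def top_pad[OF n y] by (simp add: a_kernel_def')
      then have "pad_map i (D i) x = (\<lambda>_. \<zero>\<^bsub>R\<^esub>)"
        using R.free_left_module_coord_closed[OF y]
        by (auto simp: pad_map_def[of i] fun_eq_iff) (auto simp: x_def pad_map_def Suc_diff_le)
      with x show "x \<in> a_kernel (?G (Suc i)) (?G i) (pad_map i (D i))"
        by (simp add: a_kernel_def')
    next
      fix x assume "x \<in> a_kernel (?G (Suc i)) (?G i) (pad_map i (D i))"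
      then have x: "x \<in> carrier (?G (Suc i))" and ker: "pad_map i (D i) x (j, l) = \<zero>\<^bsub>R\<^esub>" for j l
        by (auto simp: a_kernel_def')
      note xc = R.free_left_module_coord_closed[OF x]
      have Dx: "D i (\<lambda>k. \<pi> (x (Suc i, k))) = (\<lambda>_. \<zero>\<^bsub>Q\<^esub>)"
        using top_pad[OF i x] ker by simp
      then have "(\<lambda>k. \<pi> (x (Suc i, k))) \<in> D (Suc i) ` carrier (?F (Suc (Suc i)))"
        unfolding ex using top_coords[OF x] by (simp add: a_kernel_def')
      then obtain v where v: "v \<in> carrier (?F (Suc (Suc i)))" "D (Suc i) v = (\<lambda>k. \<pi> (x (Suc i, k)))" by auto
      show "x \<in> pad_map (Suc i) (D (Suc i)) ` carrier (?G (Suc (Suc i)))"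
      proof (rule pad_map_lift[OF D[OF n] x v])
        fix j l assume "j < Suc i" "even (Suc i - j)"
        then have "\<iota> (\<pi> (x (j, l))) = \<zero>\<^bsub>R\<^esub>"
          using ker[of j l] by (auto simp: pad_map_def Suc_diff_le split: if_splits)
        then show "\<pi> (x (j, l)) = \<zero>\<^bsub>Q\<^esub>"
          using \<pi>_\<iota>[OF \<pi>_closed[OF xc]] by (metis \<pi>_zero)
      next
        fix j l assume "j < Suc i" "odd (Suc i - j)"
        then show "compl_part (x (j, l)) = \<zero>\<^bsub>R\<^esub>"
          using ker[of j l] xc Dx by (auto simp: pad_map_def Suc_diff_le split: if_splits)
      qed
    qed
  qed
qed

end

section \<open>Fixed points of monoids of type left-\<open>FP\<^sub>1\<close>\<close>

lemma frag_cmul_sum_left: "(\<Sum>i\<in>I. frag_cmul (a i) c) = frag_cmul (\<Sum>i\<in>I. a i) c"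
  by (induction I rule: infinite_finite_induct) (simp_all add: frag_cmul_distrib)

lemma frag_action_sum_right: "frag_action q f (\<Sum>i\<in>I. g i) = (\<Sum>i\<in>I. frag_action q f (g i))"
  by (induction I rule: infinite_finite_induct) (simp_all add: frag_action_add_right)

lemma frag_action_fixed:
  assumes "\<And>s. s \<in> Poly_Mapping.keys f \<Longrightarrow> q s y = y"
  shows "frag_action q f (frag_of y) = frag_cmul (augmentation f) (frag_of y)"
proof -
  have "Poly_Mapping.keys f \<subseteq> {s. q s y = y}" using assms by blast
  then show ?thesis
    by (induction f rule: frag_induction)
      (simp_all add: frag_action_diff_left augmentation_diff frag_cmul_diff_distrib)
qed

lemma augmentation_resolution_formula:
  assumes "monoid S" "finite I"
    and \<epsilon>: "\<epsilon> \<in> left_module_hom (monoid_ring S) (free_left_module (monoid_ring S) I) trivial_left_module"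
    and x: "x \<in> carrier (free_left_module (monoid_ring S) I)"
  shows "\<epsilon> x = (\<Sum>i\<in>I. \<epsilon> (unit_vector (monoid_ring S) i) * augmentation (x i))"
proof -
  interpret ring "monoid_ring S" by (rule ring_monoid_ring) fact
  let ?F = "free_left_module (monoid_ring S) I"
  show ?thesis
    using assms(2) x
  proof (induction rule: free_left_module_induct)
    case (unit i)
    have "(\<Sum>l\<in>I. \<epsilon> (unit_vector (monoid_ring S) l) * augmentation (unit_vector (monoid_ring S) i l)) =
        (\<Sum>l\<in>I. if l = i then \<epsilon> (unit_vector (monoid_ring S) i) else 0)"
      by (rule sum.cong) (auto simp: unit_vector_def)
    then show ?case using unit assms(2) by simp
  next
    case (add x y)
    then show ?case
      using left_module_hom_add[OF \<epsilon> add(1,2)]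
      by (simp add: augmentation_add distrib_left sum.distrib)
  next
    case (smult r x)
    then show ?case
      using left_module_hom_smult[OF \<epsilon> smult(1,2)]
      by (simp add: augmentation_frag_action sum_distrib_left algebra_simps)
  next
    case zero
    show ?case
      using left_module_hom_zero[OF left_module_free left_module_trivial \<epsilon>] assms(1) by simp
  qed
qed

text \<open>Let \<open>X\<close> be the set acted on. Type \<open>FP\<^sub>1\<close> says that the trivial module is finitely presented. For each
point \<open>y\<close> there is a linear map \<open>\<Lambda>\<close> from \<open>F\<^sub>0\<close> to the permutation module \<open>\<int>X\<close> that sends a
basis vector \<open>b\<close> to \<open>\<epsilon> b\<close> times \<open>y\<close>. If \<open>y\<close> is fixed by the finitely many monoid elements that
occur in the relations, then \<open>\<Lambda>\<close> kills the relations and so factors through \<open>\<epsilon>\<close>; hence its image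
consists of invariant elements. If \<open>y\<close> is fixed by the elements occurring in some \<open>u\<close> with \<open>\<epsilon> u = 1\<close>
as well, then \<open>y = \<Lambda> u\<close> is one of them.\<close>

lemma global_fixed_point:
  fixes q :: "'s \<Rightarrow> 'x \<Rightarrow> 'x" and S :: "'s monoid"
  assumes "monoid S" and n: "0 < n"
    and fin: "finite (I 0)" "finite (I 1)"
    and res: "partial_resolution (monoid_ring S) trivial_left_module n
      (\<lambda>i. free_left_module (monoid_ring S) (I i)) d \<epsilon>"
    and act_one: "\<And>y. q \<one>\<^bsub>S\<^esub> y = y"
    and act_mult: "\<And>s t y. \<lbrakk>s \<in> carrier S; t \<in> carrier S\<rbrakk> \<Longrightarrow> q (s \<otimes>\<^bsub>S\<^esub> t) y = q s (q t y)"
    and local_fixed: "\<And>U. \<lbrakk>finite U; U \<subseteq> carrier S\<rbrakk> \<Longrightarrow> \<exists>y. \<forall>s\<in>U. q s y = y"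
  shows "\<exists>y. \<forall>s\<in>carrier S. q s y = y"
proof -
  interpret S: monoid S by fact
  interpret ring "monoid_ring S" by (rule ring_monoid_ring) fact
  let ?R = "monoid_ring S"
  let ?F = "\<lambda>i. free_left_module ?R (I i)"
  have d: "d 0 \<in> left_module_hom ?R (?F 1) (?F 0)"
    and \<epsilon>: "\<epsilon> \<in> left_module_hom ?R (?F 0) trivial_left_module"
    and ex: "d 0 ` carrier (?F 1) = {x \<in> carrier (?F 0). \<epsilon> x = 0}"
    using res n by (auto simp: partial_resolution_def a_kernel_def')
  have keys: "Poly_Mapping.keys (x i) \<subseteq> carrier S" if "x \<in> carrier (?F j)" for x i j
    using free_left_module_coord_closed[OF that, of i] by simp
  have "1 \<in> \<epsilon> ` carrier (?F 0)"
    using res by (simp add: partial_resolution_def)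
  then obtain u where u: "u \<in> carrier (?F 0)" "\<epsilon> u = 1" by auto
  let ?b = "\<lambda>j. d 0 (unit_vector ?R j)"
  have b: "?b j \<in> carrier (?F 0)" "\<epsilon> (?b j) = 0" if "j \<in> I 1" for j
    using unit_vector_closed[OF that] ex by blast+
  define U where "U = (\<Union>i\<in>I 0. Poly_Mapping.keys (u i)) \<union> (\<Union>j\<in>I 1. \<Union>i\<in>I 0. Poly_Mapping.keys (?b j i))"
  have "finite U" using fin by (simp add: U_def)
  moreover have "U \<subseteq> carrier S" using keys u(1) b(1) by (fastforce simp: U_def)
  ultimately have "\<exists>y. \<forall>s\<in>U. q s y = y" by (rule local_fixed)
  then obtain y where y: "\<And>s. s \<in> U \<Longrightarrow> q s y = y" by blast
  define \<Lambda> where "\<Lambda> x = (\<Sum>i\<in>I 0. frag_cmul (\<epsilon> (unit_vector ?R i)) (frag_action q (x i) (frag_of y)))" for x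
  have \<Lambda>_fixed: "\<Lambda> x = frag_cmul (\<epsilon> x) (frag_of y)"
    if x: "x \<in> carrier (?F 0)" and "\<And>i. i \<in> I 0 \<Longrightarrow> Poly_Mapping.keys (x i) \<subseteq> U" for x
  proof -
    have "\<Lambda> x = (\<Sum>i\<in>I 0. frag_cmul (\<epsilon> (unit_vector ?R i)) (frag_cmul (augmentation (x i)) (frag_of y)))"
      unfolding \<Lambda>_def using that(2) y by (intro sum.cong arg_cong2[where f = frag_cmul] frag_action_fixed) auto
    also have "\<dots> = frag_cmul (\<epsilon> x) (frag_of y)"
      unfolding augmentation_resolution_formula[OF assms(1) fin(1) \<epsilon> x]
      by (simp add: frag_cmul_sum_left)
    finally show ?thesis .
  qed
  have \<Lambda>_add: "\<Lambda> (x \<oplus>\<^bsub>?F 0\<^esub> x') = \<Lambda> x + \<Lambda> x'" for x x'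
    by (simp add: \<Lambda>_def frag_action_add_left frag_cmul_distrib2 sum.distrib)
  have \<Lambda>_smult: "\<Lambda> (r \<odot>\<^bsub>?F 0\<^esub> x) = frag_action q r (\<Lambda> x)"
    if "r \<in> carrier ?R" "x \<in> carrier (?F 0)" for r x
  proof -
    have "frag_action q (frag_action (mult S) r (x i)) (frag_of y) =
        frag_action q r (frag_action q (x i) (frag_of y))" for i
      using that(1) keys[OF that(2)] act_mult
      by (intro frag_action_assoc[of _ "carrier S" _ _ UNIV]) auto
    then show ?thesis
      by (simp add: \<Lambda>_def frag_action_sum_right frag_action_cmul_right)
  qed
  have \<Lambda>_d: "\<Lambda> (d 0 v) = 0" if "v \<in> carrier (?F 1)" for v
    using fin(2) that
  proof (induction rule: free_left_module_induct)
    case (unit j)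
    then show ?case
      using \<Lambda>_fixed[OF b(1)[OF unit]] b(2)[OF unit] by (auto simp: U_def)
  next
    case (add v w)
    then show ?case
      using \<Lambda>_add left_module_hom_add[OF d add(1,2)] by simp
  next
    case (smult r v)
    then show ?case
      using \<Lambda>_smult[OF smult(1) left_module_hom_closed[OF d smult(2)]] left_module_hom_smult[OF d smult(1,2)]
      by simp
  next
    case zero
    show ?case
      using left_module_hom_zero[OF left_module_free left_module_free d] by (simp add: \<Lambda>_def)
  qed
  have "q t y = y" if t: "t \<in> carrier S" for t
  proof -
    \<comment> \<open>Since \<open>\<epsilon>\<close> is invariant, \<open>(t - 1) u\<close> is a relation, so \<open>\<Lambda>\<close> kills it.\<close>
    let ?r = "frag_of t - frag_of \<one>\<^bsub>S\<^esub>"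
    have r: "?r \<in> carrier ?R"
      using t keys_diff[of "frag_of t" "frag_of \<one>\<^bsub>S\<^esub>"] by auto
    interpret F: left_module ?R "?F 0" by (rule left_module_free)
    have "?r \<odot>\<^bsub>?F 0\<^esub> u \<in> carrier (?F 0)" "\<epsilon> (?r \<odot>\<^bsub>?F 0\<^esub> u) = 0"
      using F.smult_closed[OF r u(1)] left_module_hom_smult[OF \<epsilon> r u(1)]
      by (simp_all add: augmentation_diff)
    then have "?r \<odot>\<^bsub>?F 0\<^esub> u \<in> d 0 ` carrier (?F 1)" unfolding ex by blast
    then have "\<Lambda> (?r \<odot>\<^bsub>?F 0\<^esub> u) = 0" using \<Lambda>_d by fastforce
    moreover have "\<Lambda> u = frag_of y"
      using \<Lambda>_fixed[OF u(1)] u(2) by (auto simp: U_def)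
    ultimately have "frag_of (q t y) - frag_of (q \<one>\<^bsub>S\<^esub> y) = 0"
      using \<Lambda>_smult[OF r u(1)] by (simp add: frag_action_diff_left)
    then show ?thesis by (simp add: act_one frag_of_eq)
  qed
  then show ?thesis by blast
qed

section \<open>Retracts of monoids\<close>

text \<open>Identities in monoid rings need to be checked on monoid elements only.\<close>

lemma biadditive_eq:
  fixes B C :: "('s \<Rightarrow>\<^sub>0 int) \<Rightarrow> ('x \<Rightarrow>\<^sub>0 int) \<Rightarrow> ('z \<Rightarrow>\<^sub>0 int)"
  assumes "\<And>f g m. B (f - g) m = B f m - B g m" "\<And>f m k. B f (m - k) = B f m - B f k"
    and "\<And>f g m. C (f - g) m = C f m - C g m" "\<And>f m k. C f (m - k) = C f m - C f k"
    and agree: "\<And>s x. \<lbrakk>s \<in> U; x \<in> V\<rbrakk> \<Longrightarrow> B (frag_of s) (frag_of x) = C (frag_of s) (frag_of x)"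
    and f: "Poly_Mapping.keys f \<subseteq> U" and m: "Poly_Mapping.keys m \<subseteq> V"
  shows "B f m = C f m"
proof -
  have zero: "B 0 m = 0" "C 0 m = 0" "B f 0 = 0" "C f 0 = 0" for f m
    using assms(1)[of 0 0 m] assms(2)[of f 0 0] assms(3)[of 0 0 m] assms(4)[of f 0 0] by simp_all
  show ?thesis
    using f
  proof (induction f rule: frag_induction)
    case (one s)
    show ?case using m
      by (induction m rule: frag_induction) (simp_all add: zero agree one assms(2,4))
  qed (simp_all add: zero assms(1,3))
qed

text \<open>A retraction \<open>p\<close> of monoids for which \<open>j\<close> is equivariant on both sides is multiplication by the
central idempotent \<open>j \<one>\<close> and makes the monoid ring of \<open>M\<close> a direct factor of that of \<open>T\<close>. In general
\<open>j \<one>\<close> differs from the identity of \<open>T\<close>.\<close>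

lemma ring_retract_monoid_rings:
  assumes "monoid T" "monoid M"
    and p: "p \<in> hom T M" "p \<one>\<^bsub>T\<^esub> = \<one>\<^bsub>M\<^esub>"
    and j: "\<And>a. a \<in> carrier M \<Longrightarrow> j a \<in> carrier T" "\<And>a. a \<in> carrier M \<Longrightarrow> p (j a) = a"
    and left: "\<And>s a. \<lbrakk>s \<in> carrier T; a \<in> carrier M\<rbrakk> \<Longrightarrow> j (p s \<otimes>\<^bsub>M\<^esub> a) = s \<otimes>\<^bsub>T\<^esub> j a"
    and right: "\<And>s a. \<lbrakk>s \<in> carrier T; a \<in> carrier M\<rbrakk> \<Longrightarrow> j (a \<otimes>\<^bsub>M\<^esub> p s) = j a \<otimes>\<^bsub>T\<^esub> s"
  shows "ring_retract_modules (monoid_ring T) (monoid_ring M)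
    (frag_extend (\<lambda>s. frag_of (p s))) (frag_extend (\<lambda>a. frag_of (j a)))
    trivial_left_module trivial_left_module"
    (is "ring_retract_modules ?R ?Q ?\<pi> ?\<iota> _ _")
proof -
  interpret R: ring ?R by (rule ring_monoid_ring) fact
  interpret Q: ring ?Q by (rule ring_monoid_ring) fact
  have \<pi>_closed: "?\<pi> f \<in> carrier ?Q" if "f \<in> carrier ?R" for f
    using that p(1) keys_frag_extend[of "\<lambda>s. frag_of (p s)" f] hom_in_carrier[OF p(1)] by fastforce
  have \<iota>_closed: "?\<iota> g \<in> carrier ?R" if "g \<in> carrier ?Q" for g
    using that j(1) keys_frag_extend[of "\<lambda>a. frag_of (j a)" g] by fastforce
  have "?\<pi> (frag_action (mult T) f g) = frag_action (mult M) (?\<pi> f) (?\<pi> g)"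
    if "f \<in> carrier ?R" "g \<in> carrier ?R" for f g
    by (rule biadditive_eq[where B = "\<lambda>f g. ?\<pi> (frag_action (mult T) f g)"
          and C = "\<lambda>f g. frag_action (mult M) (?\<pi> f) (?\<pi> g)" and U = "carrier T" and V = "carrier T"])
      (use that hom_mult[OF p(1)] in
        \<open>simp_all add: frag_extend_diff frag_action_diff_left frag_action_diff_right\<close>)
  then have \<pi>_hom: "?\<pi> \<in> ring_hom ?R ?Q"
    using \<pi>_closed by (auto simp: ring_hom_def frag_extend_add p(2))
  have \<pi>_\<iota>: "?\<pi> (?\<iota> g) = g" if "g \<in> carrier ?Q" for g
  proof -
    from that have "Poly_Mapping.keys g \<subseteq> carrier M" by simp
    then show ?thesis
      by (induction g rule: frag_induction) (simp_all add: frag_extend_diff j(2))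
  qed
  have \<iota>_left: "?\<iota> (frag_action (mult M) (?\<pi> f) g) = frag_action (mult T) f (?\<iota> g)"
    if "f \<in> carrier ?R" "g \<in> carrier ?Q" for f g
    by (rule biadditive_eq[where B = "\<lambda>f g. ?\<iota> (frag_action (mult M) (?\<pi> f) g)"
          and C = "\<lambda>f g. frag_action (mult T) f (?\<iota> g)" and U = "carrier T" and V = "carrier M"])
      (use that left in \<open>simp_all add: frag_extend_diff frag_action_diff_left frag_action_diff_right\<close>)
  have \<iota>_right: "?\<iota> (frag_action (mult M) g (?\<pi> f)) = frag_action (mult T) (?\<iota> g) f"
    if "f \<in> carrier ?R" "g \<in> carrier ?Q" for f g
    by (rule biadditive_eq[where B = "\<lambda>f g. ?\<iota> (frag_action (mult M) g (?\<pi> f))"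
          and C = "\<lambda>f g. frag_action (mult T) (?\<iota> g) f" and U = "carrier T" and V = "carrier M"])
      (use that right in \<open>simp_all add: frag_extend_diff frag_action_diff_left frag_action_diff_right\<close>)
  have aug: "augmentation (?\<pi> f) = augmentation f" for f
    by (induction f rule: frag_induction[OF subset_UNIV]) (simp_all add: frag_extend_diff augmentation_diff)
  show ?thesis
    by (intro ring_retract_modules.intro ring_retract.intro ring_retract_axioms.intro
        ring_retract_modules_axioms.intro R.ring_axioms Q.ring_axioms left_module_trivial assms(1,2)
        \<pi>_hom \<iota>_closed \<pi>_\<iota>)
      (use \<iota>_left \<iota>_right in \<open>simp_all add: frag_extend_add aug\<close>)
qed

lemma monoid_left_FP_retract:
  assumes "monoid T" "monoid M"
    and "p \<in> hom T M" "p \<one>\<^bsub>T\<^esub> = \<one>\<^bsub>M\<^esub>"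
    and "\<And>a. a \<in> carrier M \<Longrightarrow> j a \<in> carrier T" "\<And>a. a \<in> carrier M \<Longrightarrow> p (j a) = a"
    and "\<And>s a. \<lbrakk>s \<in> carrier T; a \<in> carrier M\<rbrakk> \<Longrightarrow> j (p s \<otimes>\<^bsub>M\<^esub> a) = s \<otimes>\<^bsub>T\<^esub> j a"
    and "\<And>s a. \<lbrakk>s \<in> carrier T; a \<in> carrier M\<rbrakk> \<Longrightarrow> j (a \<otimes>\<^bsub>M\<^esub> p s) = j a \<otimes>\<^bsub>T\<^esub> s"
  shows "monoid_left_FP n T \<longleftrightarrow> monoid_left_FP n M"
proof -
  interpret ring_retract_modules "monoid_ring T" "monoid_ring M"
    "frag_extend (\<lambda>s. frag_of (p s))" "frag_extend (\<lambda>a. frag_of (j a))"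
    trivial_left_module trivial_left_module
    by (rule ring_retract_monoid_rings) (fact assms)+
  show ?thesis
  proof
    assume "monoid_left_FP n T"
    then obtain k :: "nat \<Rightarrow> nat" and d \<epsilon> where "partial_resolution (monoid_ring T) trivial_left_module n
        (\<lambda>i. free_left_module (monoid_ring T) {..<k i}) d \<epsilon>"
      by (rule monoid_left_FP_coordinates[OF assms(1)])
    from monoid_left_FP_if_resolution[OF assms(2) _ partial_resolution_descend[OF this]]
    show "monoid_left_FP n M" by simp
  next
    assume "monoid_left_FP n M"
    then obtain k :: "nat \<Rightarrow> nat" and d \<epsilon> where "partial_resolution (monoid_ring M) trivial_left_module n
        (\<lambda>i. free_left_module (monoid_ring M) {..<k i}) d \<epsilon>"
      by (rule monoid_left_FP_coordinates[OF assms(2)])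
    from monoid_left_FP_if_resolution[OF assms(1) _ partial_resolution_ascend[OF this]]
    show "monoid_left_FP n T" by (simp add: finite_pad_index)
  qed
qed

section \<open>Strong semilattices of monoids\<close>

context strong_semilattice_of_monoids
begin

abbreviation "S \<equiv> strong_semilattice_carrier A"
abbreviation times_S (infixl "\<cdot>" 70) where "a \<cdot> b \<equiv> strong_semilattice_mult A \<phi> a b"

lemma component_index_eq: "a \<in> carrier (A \<alpha>) \<Longrightarrow> component_index A a = \<alpha>"
  unfolding component_index_def using disjoint_components by (blast intro: the_equality)

lemma in_carrierI: "a \<in> carrier (A \<alpha>) \<Longrightarrow> a \<in> S"
  by (auto simp: strong_semilattice_carrier_def)

lemma in_component: "a \<in> S \<Longrightarrow> a \<in> carrier (A (component_index A a))"
  by (auto simp: strong_semilattice_carrier_def component_index_eq)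

lemma \<phi>_closed: "\<lbrakk>\<beta> \<le> \<alpha>; a \<in> carrier (A \<alpha>)\<rbrakk> \<Longrightarrow> \<phi> \<alpha> \<beta> a \<in> carrier (A \<beta>)"
  using structure_hom by (blast intro: hom_in_carrier)

lemma \<phi>_mult: "\<lbrakk>\<beta> \<le> \<alpha>; a \<in> carrier (A \<alpha>); b \<in> carrier (A \<alpha>)\<rbrakk> \<Longrightarrow>
    \<phi> \<alpha> \<beta> (a \<otimes>\<^bsub>A \<alpha>\<^esub> b) = \<phi> \<alpha> \<beta> a \<otimes>\<^bsub>A \<beta>\<^esub> \<phi> \<alpha> \<beta> b"
  using structure_hom by (blast intro: hom_mult)

lemma mult_eq: "\<lbrakk>a \<in> carrier (A \<alpha>); b \<in> carrier (A \<beta>)\<rbrakk> \<Longrightarrow>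
    a \<cdot> b = \<phi> \<alpha> (inf \<alpha> \<beta>) a \<otimes>\<^bsub>A (inf \<alpha> \<beta>)\<^esub> \<phi> \<beta> (inf \<alpha> \<beta>) b"
  by (simp add: strong_semilattice_mult_def component_index_eq Let_def)

lemma mult_in_component: "\<lbrakk>a \<in> carrier (A \<alpha>); b \<in> carrier (A \<beta>)\<rbrakk> \<Longrightarrow> a \<cdot> b \<in> carrier (A (inf \<alpha> \<beta>))"
  unfolding mult_eq by (intro monoid.m_closed monoid_component \<phi>_closed inf_le1 inf_le2)

lemma mult_closed: "\<lbrakk>a \<in> S; b \<in> S\<rbrakk> \<Longrightarrow> a \<cdot> b \<in> S"
  using in_component mult_in_component in_carrierI by blast

lemma component_index_mult:
  "\<lbrakk>a \<in> S; b \<in> S\<rbrakk> \<Longrightarrow> component_index A (a \<cdot> b) = inf (component_index A a) (component_index A b)"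
  using in_component mult_in_component component_index_eq by blast

text \<open>The structure maps are multiplicative across components, with respect to the product of \<open>S\<close>. Both
associativity of that product and the retraction onto the least component rest on this.\<close>

lemma \<phi>_strong_mult:
  assumes "a \<in> carrier (A \<alpha>)" "b \<in> carrier (A \<beta>)" "\<delta> \<le> inf \<alpha> \<beta>"
  shows "\<phi> (inf \<alpha> \<beta>) \<delta> (a \<cdot> b) = \<phi> \<alpha> \<delta> a \<otimes>\<^bsub>A \<delta>\<^esub> \<phi> \<beta> \<delta> b"
  using assms by (simp add: mult_eq \<phi>_mult \<phi>_closed structure_comp)

lemma mult_assoc:
  assumes "a \<in> S" "b \<in> S" "c \<in> S"
  shows "(a \<cdot> b) \<cdot> c = a \<cdot> (b \<cdot> c)"
proof -
  obtain \<alpha> \<beta> \<gamma> where abc: "a \<in> carrier (A \<alpha>)" "b \<in> carrier (A \<beta>)" "c \<in> carrier (A \<gamma>)"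
    using assms in_component by blast
  define \<delta> where "\<delta> = inf (inf \<alpha> \<beta>) \<gamma>"
  have \<delta>': "inf \<alpha> (inf \<beta> \<gamma>) = \<delta>" by (simp add: \<delta>_def inf_assoc)
  have le: "\<delta> \<le> inf \<alpha> \<beta>" "\<delta> \<le> inf \<beta> \<gamma>" "\<delta> \<le> \<alpha>" "\<delta> \<le> \<beta>" "\<delta> \<le> \<gamma>"
    by (auto simp: \<delta>_def intro: le_infI1 le_infI2)
  interpret monoid "A \<delta>" by (rule monoid_component)
  show ?thesis
    using mult_eq[OF mult_in_component[OF abc(1,2)] abc(3)] mult_eq[OF abc(1) mult_in_component[OF abc(2,3)]]
    unfolding \<delta>' \<delta>_def[symmetric]
    by (simp add: \<phi>_strong_mult abc le m_assoc \<phi>_closed)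
qed

end

text \<open>The monoid \<open>T\<close> is \<open>S\<close> together with an identity, which may or may not lie in \<open>S\<close>. This treats at once
the case of a semigroup with identity and that of an adjoined one, for which the element types differ.\<close>

locale strong_semilattice_with_one = strong_semilattice_of_monoids A \<phi> + T: monoid T
  for A :: "'y::semilattice_inf \<Rightarrow> 'a monoid" and \<phi> and T :: "'t monoid" and emb :: "'a \<Rightarrow> 't" +
  assumes carrier_T: "carrier T = insert \<one>\<^bsub>T\<^esub> (emb ` S)"
    and inj_emb: "inj_on emb S"
    and emb_mult: "\<lbrakk>a \<in> S; b \<in> S\<rbrakk> \<Longrightarrow> emb (a \<cdot> b) = emb a \<otimes>\<^bsub>T\<^esub> emb b"
begin

lemma emb_closed: "a \<in> S \<Longrightarrow> emb a \<in> carrier T"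
  by (simp add: carrier_T)

lemma inv_emb [simp]: "a \<in> S \<Longrightarrow> inv_into S emb (emb a) = a"
  by (rule inv_into_f_f[OF inj_emb])

lemma emb_one:
  assumes "u \<in> S" "emb u = \<one>\<^bsub>T\<^esub>" "a \<in> S"
  shows "u \<cdot> a = a"
  using assms inj_emb emb_mult[of u a] mult_closed[of u a] emb_closed by (auto dest: inj_onD)

text \<open>The action of \<open>T\<close> on \<open>Y\<close> through the index map, with the identity acting trivially. If the identity
lies in \<open>S\<close>, its index is the greatest element of \<open>Y\<close> and the two clauses agree, see
\<open>act_emb\<close> below.\<close>

definition act :: "'t \<Rightarrow> 'y \<Rightarrow> 'y" where
  "act t y = (if t = \<one>\<^bsub>T\<^esub> then y else inf (component_index A (inv_into S emb t)) y)"

lemma act_emb: "a \<in> S \<Longrightarrow> act (emb a) y = inf (component_index A a) y"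
proof (cases "emb a = \<one>\<^bsub>T\<^esub>")
  case True
  assume a: "a \<in> S"
  interpret monoid "A y" by (rule monoid_component)
  have "a \<cdot> \<one>\<^bsub>A y\<^esub> = \<one>\<^bsub>A y\<^esub>"
    using emb_one[OF a True in_carrierI[OF one_closed]] .
  then have "inf (component_index A a) y = y"
    using component_index_mult[OF a in_carrierI[OF one_closed]] component_index_eq[OF one_closed] by simp
  with True show ?thesis by (simp add: act_def)
qed (simp add: act_def)

lemma T_cases:
  assumes "t \<in> carrier T"
  obtains "t = \<one>\<^bsub>T\<^esub>" | a where "a \<in> S" "t = emb a"
  using assms by (auto simp: carrier_T)

lemma act_one: "act \<one>\<^bsub>T\<^esub> y = y"
  by (simp add: act_def)

lemma act_inf: "t \<in> carrier T \<Longrightarrow> act t (inf z y) = inf z (act t y)"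
  by (erule T_cases) (simp_all add: act_one act_emb inf_left_commute)

lemma act_mult:
  assumes "s \<in> carrier T" "t \<in> carrier T"
  shows "act (s \<otimes>\<^bsub>T\<^esub> t) y = act s (act t y)"
  using assms(1)
proof (cases rule: T_cases)
  case (2 a)
  note a = this
  from assms(2) show ?thesis
  proof (cases rule: T_cases)
    case (2 b)
    have "s \<otimes>\<^bsub>T\<^esub> t = emb (a \<cdot> b)" using a 2 by (simp add: emb_mult)
    then show ?thesis
      using a 2 by (simp add: act_emb component_index_mult mult_closed inf_assoc)
  qed (use assms in \<open>simp add: act_one\<close>)
qed (use assms in \<open>simp add: act_one\<close>)

lemma least_if_monoid_left_FP:
  assumes "monoid_left_FP n T" "1 \<le> n"
  shows "\<exists>e. \<forall>y. e \<le> (y::'y)"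
proof -
  obtain k :: "nat \<Rightarrow> nat" and d \<epsilon> where "partial_resolution (monoid_ring T) trivial_left_module n
        (\<lambda>i. free_left_module (monoid_ring T) {..<k i}) d \<epsilon>"
    by (rule monoid_left_FP_coordinates[OF T.monoid_axioms assms(1)])
  then have "\<exists>y. \<forall>s\<in>carrier T. act s y = y"
  proof (rule global_fixed_point[OF T.monoid_axioms, rotated 3])
    fix U assume "finite U" "U \<subseteq> carrier T"
    then show "\<exists>y. \<forall>s\<in>U. act s y = y"
    proof (induction U rule: finite_induct)
      case (insert t U)
      then obtain y where y: "\<forall>s\<in>U. act s y = y" by auto
      have "t \<in> carrier T" using insert.prems by simp
      then show ?case
      proof (cases rule: T_cases)
        case 1
        with y show ?thesis by (auto simp: act_one)
      next
        case (2 a)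
        have "act s (inf (component_index A a) y) = inf (component_index A a) y" if "s \<in> U" for s
          using y that act_inf[of s] insert.prems by auto
        then show ?thesis
          using 2 by (intro exI[of _ "inf (component_index A a) y"]) (simp add: act_emb)
      qed
    qed simp
  qed (use assms(2) in \<open>auto simp: act_one act_mult\<close>)
  then obtain e where e: "act s e = e" if "s \<in> carrier T" for s by blast
  have "e \<le> y" for y
  proof -
    interpret monoid "A y" by (rule monoid_component)
    have "inf y e = e"
      using e[OF emb_closed[OF in_carrierI[OF one_closed]]] act_emb[OF in_carrierI[OF one_closed], of e]
        component_index_eq[OF one_closed] by simp
    then show ?thesis by (metis inf_le1)
  qed
  then show ?thesis by blast
qed

text \<open>The retraction is \<open>p s = s z\<close> for the identity \<open>z\<close> of \<open>A\<^sub>e\<close>, that is, the structure map into \<open>A\<^sub>e\<close> on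
each component. If the identity of \<open>T\<close> is some \<open>u\<close> in \<open>S\<close>, then \<open>p u = u z = z\<close>, so that the structure
map at \<open>u\<close> preserves the identity although structure maps in general may not.\<close>

lemma monoid_left_FP_iff_component:
  assumes e: "\<And>y. e \<le> (y::'y)"
  shows "monoid_left_FP n T \<longleftrightarrow> monoid_left_FP n (A e)"
proof -
  interpret E: monoid "A e" by (rule monoid_component)
  define p where "p t = (if t = \<one>\<^bsub>T\<^esub> then \<one>\<^bsub>A e\<^esub>
    else \<phi> (component_index A (inv_into S emb t)) e (inv_into S emb t))" for t
  have inf_e: "inf y e = e" "inf e y = e" for y using e[of y] by (auto simp: inf_absorb1 inf_absorb2)
  have mult_left: "b \<cdot> a = \<phi> \<beta> e b \<otimes>\<^bsub>A e\<^esub> a" and mult_right: "a \<cdot> b = a \<otimes>\<^bsub>A e\<^esub> \<phi> \<beta> e b"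
    if "b \<in> carrier (A \<beta>)" "a \<in> carrier (A e)" for a b \<beta>
    using that by (simp_all add: mult_eq inf_e structure_id)
  have p_emb: "p (emb a) = \<phi> \<alpha> e a" if a: "a \<in> carrier (A \<alpha>)" for a \<alpha>
  proof (cases "emb a = \<one>\<^bsub>T\<^esub>")
    case True
    have "\<phi> \<alpha> e a = a \<cdot> \<one>\<^bsub>A e\<^esub>"
      using mult_left[OF a, of "\<one>\<^bsub>A e\<^esub>"] \<phi>_closed[OF e a] by simp
    also have "\<dots> = \<one>\<^bsub>A e\<^esub>"
      using emb_one[OF in_carrierI[OF a] True] in_carrierI[OF E.one_closed] by simp
    finally show ?thesis using True by (simp add: p_def)
  qed (use a in \<open>simp add: p_def in_carrierI component_index_eq\<close>)
  have p_one: "p \<one>\<^bsub>T\<^esub> = \<one>\<^bsub>A e\<^esub>" by (simp add: p_def)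
  have p_closed: "p t \<in> carrier (A e)" if "t \<in> carrier T" for t
    using that by (cases rule: T_cases) (auto simp: p_one p_emb[OF in_component] \<phi>_closed[OF e in_component])
  have p_mult: "p (s \<otimes>\<^bsub>T\<^esub> t) = p s \<otimes>\<^bsub>A e\<^esub> p t" if "s \<in> carrier T" "t \<in> carrier T" for s t
    using that(1)
  proof (cases rule: T_cases)
    case (2 a)
    note a = this
    from that(2) show ?thesis
    proof (cases rule: T_cases)
      case (2 b)
      note b = this
      have "s \<otimes>\<^bsub>T\<^esub> t = emb (a \<cdot> b)"
        using a b by (simp add: emb_mult)
      then show ?thesis
        using \<phi>_strong_mult[OF in_component in_component e, OF a(1) b(1)] a b
          p_emb[OF mult_in_component[OF in_component in_component, OF a(1) b(1)]]
          p_emb[OF in_component]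
        by simp
    qed (use that p_closed[OF that(1)] in \<open>simp add: p_one\<close>)
  qed (use that p_closed[OF that(2)] in \<open>simp add: p_one\<close>)
  show ?thesis
  proof (rule monoid_left_FP_retract[OF T.monoid_axioms E.monoid_axioms, of p emb])
    show "p \<in> hom T (A e)" using p_closed p_mult by (simp add: hom_def)
    show "p \<one>\<^bsub>T\<^esub> = \<one>\<^bsub>A e\<^esub>" by (rule p_one)
    fix a assume a: "a \<in> carrier (A e)"
    show "emb a \<in> carrier T" by (rule emb_closed[OF in_carrierI[OF a]])
    show "p (emb a) = a" using a by (simp add: p_emb structure_id)
    fix s assume s: "s \<in> carrier T"
    show "emb (p s \<otimes>\<^bsub>A e\<^esub> a) = s \<otimes>\<^bsub>T\<^esub> emb a"
      using s
    proof (cases rule: T_cases)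
      case (2 b)
      then show ?thesis
        using mult_left[OF in_component a] p_emb[OF in_component] emb_mult[OF _ in_carrierI[OF a]] by simp
    qed (use a in \<open>simp add: p_one emb_closed in_carrierI\<close>)
    show "emb (a \<otimes>\<^bsub>A e\<^esub> p s) = emb a \<otimes>\<^bsub>T\<^esub> s"
      using s
    proof (cases rule: T_cases)
      case (2 b)
      then show ?thesis
        using mult_right[OF in_component a] p_emb[OF in_component] emb_mult[OF in_carrierI[OF a]] by simp
    qed (use a in \<open>simp add: p_one emb_closed in_carrierI\<close>)
  qed
qed

lemma monoid_left_FP_iff_minimal:
  assumes "1 \<le> n"
  shows "monoid_left_FP n T \<longleftrightarrow> (\<exists>e. (\<forall>y. y \<le> e \<longrightarrow> y = e) \<and> monoid_left_FP n (A e))"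
proof
  assume FP: "monoid_left_FP n T"
  then obtain e where "\<And>y. e \<le> (y::'y)" using least_if_monoid_left_FP[OF _ assms] by blast
  then show "\<exists>e. (\<forall>y. y \<le> e \<longrightarrow> y = e) \<and> monoid_left_FP n (A e)"
    using FP monoid_left_FP_iff_component by (intro exI[of _ e]) (auto intro: antisym)
next
  assume "\<exists>e. (\<forall>y. y \<le> e \<longrightarrow> y = e) \<and> monoid_left_FP n (A e)"
  then obtain e where e: "\<And>y. y \<le> e \<Longrightarrow> y = e" "monoid_left_FP n (A e)" by blast
  have "e \<le> y" for y using e(1)[OF inf_le1, of y] by (metis inf_le2)
  with e(2) show "monoid_left_FP n T" using monoid_left_FP_iff_component by blast
qed

end

theorem theorem9:
  fixes A :: "'y::semilattice_inf \<Rightarrow> 'a monoid"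
    and \<phi> :: "'y \<Rightarrow> 'y \<Rightarrow> 'a \<Rightarrow> 'a"
    and n :: nat
  assumes "strong_semilattice_of_monoids A \<phi>"
    and "n \<ge> 1"
  shows "semigroup_left_FP n (strong_semilattice_carrier A) (strong_semilattice_mult A \<phi>) \<longleftrightarrow>
    (\<exists>e. (\<forall>y. y \<le> e \<longrightarrow> y = e) \<and> monoid_left_FP n (A e))"
proof -
  interpret strong_semilattice_of_monoids A \<phi> by fact
  let ?m = "strong_semilattice_mult A \<phi>"
  show ?thesis
  proof (cases "\<exists>u. identity_of S ?m u")
    case True
    then obtain u where u: "identity_of S ?m u" by blast
    then have the_u: "(THE u. identity_of S ?m u) = u"
      by (intro the_equality) (auto simp: identity_of_def)
    let ?T = "\<lparr>carrier = S, mult = ?m, one = u\<rparr>"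
    have "monoid ?T"
      using u by (intro monoidI) (auto simp: identity_of_def mult_closed mult_assoc)
    then interpret strong_semilattice_with_one A \<phi> ?T "\<lambda>a. a"
      using u by (intro strong_semilattice_with_one.intro assms(1) strong_semilattice_with_one_axioms.intro)
        (auto simp: identity_of_def)
    show ?thesis
      using monoid_left_FP_iff_minimal[OF assms(2)] True by (simp add: semigroup_left_FP_def the_u)
  next
    case False
    let ?T = "adjoin_identity S ?m"
    have "monoid ?T"
      by (rule monoidI) (auto simp: adjoin_identity_def mult_closed mult_assoc)
    then interpret strong_semilattice_with_one A \<phi> ?T Some
      by (intro strong_semilattice_with_one.intro assms(1) strong_semilattice_with_one_axioms.intro)
        (auto simp: adjoin_identity_def)
    show ?thesis
      using monoid_left_FP_iff_minimal[OF assms(2)] False by (simp add: semigroup_left_FP_def)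
  qed
qed

end
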